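(* Let $A=\Bbbk Q/I$ be a special multiserial algebra, with $R$ a minimal set of relations such that $I=\langle R\rangle$. Suppose that every nonzero relation $\rho=\sum_{j\in J}\lambda_jp_j\in R$ satisfies the condition that for any pair of arrows $\beta,\gamma$ and any $j\in J$, both $\beta p_j^0$ and $p_j^{l_j}\gamma$ are in the ideal $I$, where $p_j^0$ and $p_j^{l_j}$ are the first and the last arrow of the path $p_j$. Then $A$ is a UMP algebra if and only if, for any zero relation $r\in R$ with length greater than two, there exists a path $u$ such that $t(u)=s(u)$ and $$R\cap\{\text{subpaths of } u^{(p)}:\ p\in\mathbb{Z}^+\}=\{r\}.$$
   Context: $\Bbbk$ is an algebraically closed field, $Q=(Q_0,Q_1,s,t)$ is a finite connected quiver, $I$ is an admissible ideal of $\Bbbk Q$. A relation is a $\Bbbk$-linear combination of paths of length at least two with the same source and the same target. $R$ consists of zero relations, i.e. paths belonging to $I$, and of nonzero relations, i.e. elements $\sum_{j\in J}\lambda_jp_j\in I$ with $J$ finite, $|J|\ge2$, $\lambda_j\in\Bbbk\setminus\{0\}$, and the $p_j$ pairwise distinct parallel paths that do not belong to $I$. The length of a path is its number of arrows. Non-composable products of arrows are $0$ in $\Bbbk Q$. $u^{(p)}$ is the composition of the cyclic path $u$ with itself $p$ times. $A$ is special multiserial if for every $\alpha\in Q_1$ there is at most one arrow $\beta$ with $\alpha\beta\notin I$ and at most one arrow $\gamma$ with $\gamma\alpha\notin I$. For a path $\mathfrak m$ in $Q$, $\mathfrak m+I$ is a maximal path of $A$ if $\mathfrak m\notin I$ and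 $\alpha\mathfrak m\in I$, $\mathfrak m\alpha\in I$ for every arrow $\alpha\in Q_1$. $A$ is a UMP algebra if every arrow extends to a unique maximal path, i.e. for every arrow $a$ there is exactly one maximal path $\mathfrak m+I$ having a representative path of which $a$ is a subpath. *)

theory Defs
  imports
    "Graph_Theory.Digraph_Component"
    "HOL-Algebra.Ideal_Product"
    "HOL-Library.Poly_Mapping"
    "HOL-Computational_Algebra.Polynomial"
begin

section \<open>Paths of a quiver\<close>

text \<open>
  A quiver is a \<^typ>\<open>('v, 'a) pre_digraph\<close>; parallel arrows and loops are allowed. Both end points
  are recorded, so that there is one stationary path for every vertex. Paths are written and
  multiplied from left to right: the product of \<open>p\<close> and \<open>q\<close> runs through \<open>p\<close> first.
\<close>

datatype ('v, 'a) qpath = Path (src: 'v) (arrows: "'a list") (tgt: 'v)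

definition is_path :: "('v, 'a) pre_digraph \<Rightarrow> ('v, 'a) qpath \<Rightarrow> bool" where
  "is_path Q p \<longleftrightarrow> pre_digraph.awalk Q (src p) (arrows p) (tgt p)"

abbreviation path_length :: "('v, 'a) qpath \<Rightarrow> nat" where
  "path_length p \<equiv> length (arrows p)"

abbreviation stationary :: "'v \<Rightarrow> ('v, 'a) qpath" where
  "stationary v \<equiv> Path v [] v"

definition arrow_path :: "('v, 'a) pre_digraph \<Rightarrow> 'a \<Rightarrow> ('v, 'a) qpath" where
  "arrow_path Q a = Path (tail Q a) [a] (head Q a)"

definition path_comp :: "('v, 'a) qpath \<Rightarrow> ('v, 'a) qpath \<Rightarrow> ('v, 'a) qpath" where
  "path_comp p q = Path (src p) (arrows p @ arrows q) (tgt q)"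

primrec path_power :: "('v, 'a) qpath \<Rightarrow> nat \<Rightarrow> ('v, 'a) qpath" where
  "path_power u 0 = stationary (src u)"
| "path_power u (Suc n) = path_comp u (path_power u n)"

definition subpath :: "('v, 'a) pre_digraph \<Rightarrow> ('v, 'a) qpath \<Rightarrow> ('v, 'a) qpath \<Rightarrow> bool" where
  "subpath Q p q \<longleftrightarrow> is_path Q p \<and>
     (\<exists>x y. is_path Q x \<and> is_path Q y \<and> tgt x = src p \<and> tgt p = src y \<and>
        q = path_comp x (path_comp p y))"


section \<open>The path algebra\<close>

definition basis_mult ::
    "('v, 'a) qpath \<Rightarrow> ('v, 'a) qpath \<Rightarrow> 'k::zero \<Rightarrow> (('v, 'a) qpath \<Rightarrow>\<^sub>0 'k)" where
  "basis_mult p q c = (if tgt p = src q then Poly_Mapping.single (path_comp p q) c else 0)"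

text \<open>
  Only the ring structure is recorded. For finitely many vertices the ring is unital and the
  scalars act through the multiples of its identity, so the ring ideals are the algebra ideals.
\<close>

definition path_algebra :: "('v, 'a) pre_digraph \<Rightarrow> (('v, 'a) qpath \<Rightarrow>\<^sub>0 'k::field) ring" where
  "path_algebra Q =
     \<lparr> carrier = {f. \<forall>p \<in> Poly_Mapping.keys f. is_path Q p},
       mult = (\<lambda>f g. \<Sum>p \<in> Poly_Mapping.keys f. \<Sum>q \<in> Poly_Mapping.keys g.
                 basis_mult p q (Poly_Mapping.lookup f p * Poly_Mapping.lookup g q)),
       one = (\<Sum>v \<in> verts Q. Poly_Mapping.single (stationary v) 1),
       zero = 0,
       add = (+) \<rparr>"

abbreviation path_elt :: "('v, 'a) qpath \<Rightarrow> (('v, 'a) qpath \<Rightarrow>\<^sub>0 'k::field)" where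
  "path_elt p \<equiv> Poly_Mapping.single p 1"

abbreviation arrow_elt :: "('v, 'a) pre_digraph \<Rightarrow> 'a \<Rightarrow> (('v, 'a) qpath \<Rightarrow>\<^sub>0 'k::field)" where
  "arrow_elt Q a \<equiv> path_elt (arrow_path Q a)"

lemma path_comp_simps [simp]:
  "src (path_comp p q) = src p" "tgt (path_comp p q) = tgt q"
  "arrows (path_comp p q) = arrows p @ arrows q"
  by (simp_all add: path_comp_def)

lemma path_comp_assoc: "path_comp (path_comp p q) r = path_comp p (path_comp q r)"
  by (simp add: path_comp_def)

lemma is_path_stationary [simp]: "is_path Q (stationary v) \<longleftrightarrow> v \<in> verts Q"
  by (simp add: is_path_def pre_digraph.awalk_def pre_digraph.cas.simps)

lemma is_path_src: "is_path Q p \<Longrightarrow> src p \<in> verts Q"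
  by (simp add: is_path_def pre_digraph.awalk_def)

context wf_digraph
begin

lemma is_path_tgt: "is_path G p \<Longrightarrow> tgt p \<in> verts G"
  unfolding is_path_def by (rule awalk_last_in_verts)

lemma is_path_arrow: "a \<in> arcs G \<Longrightarrow> is_path G (arrow_path G a)"
  by (simp add: is_path_def arrow_path_def awalk_def)

lemma is_path_comp:
  "is_path G p \<Longrightarrow> is_path G q \<Longrightarrow> tgt p = src q \<Longrightarrow> is_path G (path_comp p q)"
  by (simp add: is_path_def)

end

text \<open>The ring axioms hold, so the library's notions of ideal apply to \<^const>\<open>path_algebra\<close>.\<close>

lemma basis_mult_0 [simp]: "basis_mult p q 0 = 0"
  by (simp add: basis_mult_def)

lemma basis_mult_add: "basis_mult p q (a + b) = basis_mult p q a + basis_mult p q b"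
  for a :: "'k::field"
  by (simp add: basis_mult_def single_add)

lemma path_algebra_mult_superset:
  assumes "finite A" "Poly_Mapping.keys f \<subseteq> A" "finite B" "Poly_Mapping.keys g \<subseteq> B"
  shows "f \<otimes>\<^bsub>path_algebra Q\<^esub> g =
    (\<Sum>p\<in>A. \<Sum>q\<in>B. basis_mult p q (Poly_Mapping.lookup f p * Poly_Mapping.lookup g q))"
proof -
  let ?t = "\<lambda>p q. basis_mult p q (Poly_Mapping.lookup f p * Poly_Mapping.lookup g q)"
  have "(\<Sum>p\<in>A. \<Sum>q\<in>B. ?t p q) = (\<Sum>p\<in>A. \<Sum>q\<in>Poly_Mapping.keys g. ?t p q)"
    using assms by (intro sum.cong refl sum.mono_neutral_right) (auto simp: in_keys_iff)
  also have "\<dots> = (\<Sum>p\<in>Poly_Mapping.keys f. \<Sum>q\<in>Poly_Mapping.keys g. ?t p q)"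
    using assms by (intro sum.mono_neutral_right) (auto simp: in_keys_iff)
  finally show ?thesis by (simp add: path_algebra_def)
qed

lemma path_algebra_distrib_right:
  "(f + g) \<otimes>\<^bsub>path_algebra Q\<^esub> h = f \<otimes>\<^bsub>path_algebra Q\<^esub> h + g \<otimes>\<^bsub>path_algebra Q\<^esub> h"
proof -
  let ?A = "Poly_Mapping.keys f \<union> Poly_Mapping.keys g"
  have "Poly_Mapping.keys (f + g) \<subseteq> ?A" by (rule Poly_Mapping.keys_add)
  then show ?thesis
    by (simp add: path_algebra_mult_superset[of ?A _ "Poly_Mapping.keys h"]
        lookup_add distrib_right basis_mult_add sum.distrib)
qed

lemma path_algebra_distrib_left:
  "h \<otimes>\<^bsub>path_algebra Q\<^esub> (f + g) = h \<otimes>\<^bsub>path_algebra Q\<^esub> f + h \<otimes>\<^bsub>path_algebra Q\<^esub> g"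
proof -
  let ?A = "Poly_Mapping.keys f \<union> Poly_Mapping.keys g"
  have "Poly_Mapping.keys (f + g) \<subseteq> ?A" by (rule Poly_Mapping.keys_add)
  then show ?thesis
    by (simp add: path_algebra_mult_superset[of "Poly_Mapping.keys h" _ ?A]
        lookup_add distrib_left basis_mult_add sum.distrib)
qed

lemma path_algebra_mult_zero [simp]:
  "0 \<otimes>\<^bsub>path_algebra Q\<^esub> f = 0" "f \<otimes>\<^bsub>path_algebra Q\<^esub> 0 = 0"
  by (simp_all add: path_algebra_def)

lemma path_algebra_mult_sum_left:
  "(\<Sum>i\<in>S. f i) \<otimes>\<^bsub>path_algebra Q\<^esub> h = (\<Sum>i\<in>S. f i \<otimes>\<^bsub>path_algebra Q\<^esub> h)"
  by (induction S rule: infinite_finite_induct) (simp_all add: path_algebra_distrib_right)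

lemma path_algebra_mult_sum_right:
  "h \<otimes>\<^bsub>path_algebra Q\<^esub> (\<Sum>i\<in>S. f i) = (\<Sum>i\<in>S. h \<otimes>\<^bsub>path_algebra Q\<^esub> f i)"
  by (induction S rule: infinite_finite_induct) (simp_all add: path_algebra_distrib_left)

lemma path_algebra_mult_single:
  "Poly_Mapping.single p a \<otimes>\<^bsub>path_algebra Q\<^esub> Poly_Mapping.single q b = basis_mult p q (a * b)"
  by (subst path_algebra_mult_superset[of "{p}" _ "{q}"]) auto

lemma poly_mapping_sum_single:
  "f = (\<Sum>p\<in>Poly_Mapping.keys f. Poly_Mapping.single p (Poly_Mapping.lookup f p))"
  by (rule poly_mapping_eqI)
    (simp add: lookup_sum lookup_single when_def in_keys_iff)

lemma path_algebra_mult_assoc: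
  "(f \<otimes>\<^bsub>path_algebra Q\<^esub> g) \<otimes>\<^bsub>path_algebra Q\<^esub> h = f \<otimes>\<^bsub>path_algebra Q\<^esub> (g \<otimes>\<^bsub>path_algebra Q\<^esub> h)"
proof -
  have *: "(Poly_Mapping.single p a \<otimes>\<^bsub>path_algebra Q\<^esub> Poly_Mapping.single q b)
        \<otimes>\<^bsub>path_algebra Q\<^esub> Poly_Mapping.single r c
      = Poly_Mapping.single p a \<otimes>\<^bsub>path_algebra Q\<^esub>
        (Poly_Mapping.single q b \<otimes>\<^bsub>path_algebra Q\<^esub> Poly_Mapping.single r c)"
    for p q r :: "('a, 'b) qpath" and a b c :: 'c
    by (simp add: path_algebra_mult_single basis_mult_def path_comp_assoc mult.assoc)
  let ?s = "\<lambda>f. \<Sum>p\<in>Poly_Mapping.keys f. Poly_Mapping.single p (Poly_Mapping.lookup f p)"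
  have "(?s f \<otimes>\<^bsub>path_algebra Q\<^esub> ?s g) \<otimes>\<^bsub>path_algebra Q\<^esub> ?s h
      = ?s f \<otimes>\<^bsub>path_algebra Q\<^esub> (?s g \<otimes>\<^bsub>path_algebra Q\<^esub> ?s h)"
    by (simp only: path_algebra_mult_sum_left path_algebra_mult_sum_right *)
  then show ?thesis by (simp only: poly_mapping_sum_single[symmetric])
qed

lemma path_algebra_one:
  "\<one>\<^bsub>path_algebra Q\<^esub> = (\<Sum>v\<in>verts Q. path_elt (stationary v))"
  by (simp add: path_algebra_def)

lemma path_algebra_one_left:
  assumes "finite (verts Q)" "f \<in> carrier (path_algebra Q)"
  shows "\<one>\<^bsub>path_algebra Q\<^esub> \<otimes>\<^bsub>path_algebra Q\<^esub> f = f"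
proof -
  let ?f = "\<lambda>p. Poly_Mapping.single p (Poly_Mapping.lookup f p)"
  have "\<one>\<^bsub>path_algebra Q\<^esub> \<otimes>\<^bsub>path_algebra Q\<^esub> (\<Sum>p\<in>Poly_Mapping.keys f. ?f p)
      = (\<Sum>p\<in>Poly_Mapping.keys f. \<Sum>v\<in>verts Q. path_elt (stationary v) \<otimes>\<^bsub>path_algebra Q\<^esub> ?f p)"
    by (simp only: path_algebra_one path_algebra_mult_sum_right path_algebra_mult_sum_left)
  also have "\<dots> = (\<Sum>p\<in>Poly_Mapping.keys f. \<Sum>v\<in>verts Q. if v = src p then ?f p else 0)"
    by (intro sum.cong refl) (simp add: path_algebra_mult_single basis_mult_def path_comp_def)
  also have "\<dots> = (\<Sum>p\<in>Poly_Mapping.keys f. ?f p)"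
    using assms by (intro sum.cong refl) (auto simp: path_algebra_def dest: is_path_src)
  finally show ?thesis by (simp only: poly_mapping_sum_single[symmetric])
qed

lemma (in fin_digraph) path_algebra_one_right:
  assumes "f \<in> carrier (path_algebra G)"
  shows "f \<otimes>\<^bsub>path_algebra G\<^esub> \<one>\<^bsub>path_algebra G\<^esub> = f"
proof -
  let ?f = "\<lambda>p. Poly_Mapping.single p (Poly_Mapping.lookup f p)"
  have "(\<Sum>p\<in>Poly_Mapping.keys f. ?f p) \<otimes>\<^bsub>path_algebra G\<^esub> \<one>\<^bsub>path_algebra G\<^esub>
      = (\<Sum>p\<in>Poly_Mapping.keys f. \<Sum>v\<in>verts G. ?f p \<otimes>\<^bsub>path_algebra G\<^esub> path_elt (stationary v))"
    by (simp only: path_algebra_one path_algebra_mult_sum_right path_algebra_mult_sum_left)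
      (rule sum.swap)
  also have "\<dots> = (\<Sum>p\<in>Poly_Mapping.keys f. \<Sum>v\<in>verts G. if v = tgt p then ?f p else 0)"
    by (intro sum.cong refl) (auto simp: path_algebra_mult_single basis_mult_def path_comp_def)
  also have "\<dots> = (\<Sum>p\<in>Poly_Mapping.keys f. ?f p)"
    using assms by (intro sum.cong refl) (auto simp: path_algebra_def dest: is_path_tgt)
  finally show ?thesis by (simp only: poly_mapping_sum_single[symmetric])
qed

lemma path_algebra_carrier_sum:
  assumes "\<And>i. i \<in> S \<Longrightarrow> f i \<in> carrier (path_algebra Q)"
  shows "(\<Sum>i\<in>S. f i) \<in> carrier (path_algebra Q)"
  using assms
  by (induction S rule: infinite_finite_induct)
    (auto simp: path_algebra_def dest: subsetD[OF Poly_Mapping.keys_add])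

lemma (in fin_digraph) path_algebra_ring: "ring (path_algebra G)"
proof (rule ringI)
  let ?K = "path_algebra G"
  show "abelian_group ?K"
  proof (rule abelian_groupI)
    show "\<exists>y\<in>carrier ?K. y \<oplus>\<^bsub>?K\<^esub> x = \<zero>\<^bsub>?K\<^esub>" if "x \<in> carrier ?K" for x
      using that by (intro bexI[of _ "- x"]) (auto simp: path_algebra_def)
  qed (auto simp: path_algebra_def dest: subsetD[OF Poly_Mapping.keys_add])
  show "monoid ?K"
  proof (rule monoidI)
    show "x \<otimes>\<^bsub>?K\<^esub> y \<in> carrier ?K" if "x \<in> carrier ?K" "y \<in> carrier ?K" for x y
    proof -
      have "basis_mult p q (Poly_Mapping.lookup x p * Poly_Mapping.lookup y q) \<in> carrier ?K"
        if "p \<in> Poly_Mapping.keys x" "q \<in> Poly_Mapping.keys y" for p q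
        using that is_path_comp[of p q] \<open>x \<in> carrier ?K\<close> \<open>y \<in> carrier ?K\<close>
        by (auto simp: basis_mult_def path_algebra_def)
      then have "(\<Sum>p\<in>Poly_Mapping.keys x. \<Sum>q\<in>Poly_Mapping.keys y.
          basis_mult p q (Poly_Mapping.lookup x p * Poly_Mapping.lookup y q)) \<in> carrier ?K"
        by (intro path_algebra_carrier_sum)
      then show ?thesis by (simp add: path_algebra_def)
    qed
    have "(\<Sum>v\<in>verts G. path_elt (stationary v)) \<in> carrier ?K"
      by (intro path_algebra_carrier_sum) (auto simp: path_algebra_def)
    then show "\<one>\<^bsub>?K\<^esub> \<in> carrier ?K" by (simp add: path_algebra_def)
  qed (simp_all add: path_algebra_mult_assoc path_algebra_one_left path_algebra_one_right)
qed (use path_algebra_distrib_left path_algebra_distrib_right in \<open>auto simp: path_algebra_def\<close>)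


section \<open>Admissible ideals and relations\<close>

definition arrow_ideal :: "('v, 'a) pre_digraph \<Rightarrow> (('v, 'a) qpath \<Rightarrow>\<^sub>0 'k::field) set" where
  "arrow_ideal Q = Idl\<^bsub>path_algebra Q\<^esub> (arrow_elt Q ` arcs Q)"

text \<open>The powers below are powers in the monoid of ideals under \<^const>\<open>ideal_prod\<close>.\<close>

definition admissible_ideal ::
    "('v, 'a) pre_digraph \<Rightarrow> (('v, 'a) qpath \<Rightarrow>\<^sub>0 'k::field) set \<Rightarrow> bool" where
  "admissible_ideal Q I \<longleftrightarrow> ideal I (path_algebra Q) \<and>
     (\<exists>m::nat. m \<ge> 2 \<and> arrow_ideal Q [^]\<^bsub>ideals_set (path_algebra Q)\<^esub> m \<subseteq> I) \<and>
     I \<subseteq> arrow_ideal Q [^]\<^bsub>ideals_set (path_algebra Q)\<^esub> (2::nat)"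

definition is_relation ::
    "('v, 'a) pre_digraph \<Rightarrow> (('v, 'a) qpath \<Rightarrow>\<^sub>0 'k::field) \<Rightarrow> bool" where
  "is_relation Q \<rho> \<longleftrightarrow>
     (\<forall>p \<in> Poly_Mapping.keys \<rho>. is_path Q p \<and> path_length p \<ge> 2) \<and>
     (\<forall>p \<in> Poly_Mapping.keys \<rho>. \<forall>q \<in> Poly_Mapping.keys \<rho>. src p = src q \<and> tgt p = tgt q)"

definition zero_relation ::
    "('v, 'a) pre_digraph \<Rightarrow> (('v, 'a) qpath \<Rightarrow>\<^sub>0 'k::field) set \<Rightarrow> (('v, 'a) qpath \<Rightarrow>\<^sub>0 'k) \<Rightarrow> bool"
  where "zero_relation Q I \<rho> \<longleftrightarrow> is_relation Q \<rho> \<and> \<rho> \<in> I \<and> (\<exists>p. is_path Q p \<and> \<rho> = path_elt p)"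

text \<open>
  The paths \<open>p\<^sub>j\<close> of a nonzero relation with pairwise distinct \<open>p\<^sub>j\<close> and nonzero coefficients are
  exactly the \<^const>\<open>Poly_Mapping.keys\<close> of that element.
\<close>

definition nonzero_relation ::
    "('v, 'a) pre_digraph \<Rightarrow> (('v, 'a) qpath \<Rightarrow>\<^sub>0 'k::field) set \<Rightarrow> (('v, 'a) qpath \<Rightarrow>\<^sub>0 'k) \<Rightarrow> bool"
  where "nonzero_relation Q I \<rho> \<longleftrightarrow> is_relation Q \<rho> \<and> \<rho> \<in> I \<and>
     card (Poly_Mapping.keys \<rho>) \<ge> 2 \<and> (\<forall>p \<in> Poly_Mapping.keys \<rho>. path_elt p \<notin> I)"

definition minimal_relations ::
    "('v, 'a) pre_digraph \<Rightarrow> (('v, 'a) qpath \<Rightarrow>\<^sub>0 'k::field) set \<Rightarrow> (('v, 'a) qpath \<Rightarrow>\<^sub>0 'k) set \<Rightarrow> bool"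
  where "minimal_relations Q I R \<longleftrightarrow>
     (\<forall>\<rho> \<in> R. zero_relation Q I \<rho> \<or> nonzero_relation Q I \<rho>) \<and>
     I = Idl\<^bsub>path_algebra Q\<^esub> R \<and>
     (\<forall>R'. R' \<subset> R \<longrightarrow> I \<noteq> Idl\<^bsub>path_algebra Q\<^esub> R')"


section \<open>Special multiserial algebras and UMP algebras\<close>

definition special_multiserial ::
    "('v, 'a) pre_digraph \<Rightarrow> (('v, 'a) qpath \<Rightarrow>\<^sub>0 'k::field) set \<Rightarrow> bool" where
  "special_multiserial Q I \<longleftrightarrow> (\<forall>\<alpha> \<in> arcs Q.
     (\<exists>\<^sub>\<le>\<^sub>1 \<beta>. \<beta> \<in> arcs Q \<and> arrow_elt Q \<alpha> \<otimes>\<^bsub>path_algebra Q\<^esub> arrow_elt Q \<beta> \<notin> I) \<and>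
     (\<exists>\<^sub>\<le>\<^sub>1 \<gamma>. \<gamma> \<in> arcs Q \<and> arrow_elt Q \<gamma> \<otimes>\<^bsub>path_algebra Q\<^esub> arrow_elt Q \<alpha> \<notin> I))"

definition residue_class ::
    "('v, 'a) pre_digraph \<Rightarrow> (('v, 'a) qpath \<Rightarrow>\<^sub>0 'k::field) set \<Rightarrow> ('v, 'a) qpath \<Rightarrow>
      (('v, 'a) qpath \<Rightarrow>\<^sub>0 'k) set" where
  "residue_class Q I m = I +>\<^bsub>path_algebra Q\<^esub> path_elt m"

definition maximal_paths ::
    "('v, 'a) pre_digraph \<Rightarrow> (('v, 'a) qpath \<Rightarrow>\<^sub>0 'k::field) set \<Rightarrow> (('v, 'a) qpath \<Rightarrow>\<^sub>0 'k) set set"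
  where "maximal_paths Q I = {residue_class Q I m | m. is_path Q m \<and> path_elt m \<notin> I \<and>
     (\<forall>\<alpha> \<in> arcs Q. arrow_elt Q \<alpha> \<otimes>\<^bsub>path_algebra Q\<^esub> path_elt m \<in> I \<and>
                    path_elt m \<otimes>\<^bsub>path_algebra Q\<^esub> arrow_elt Q \<alpha> \<in> I)}"

definition UMP :: "('v, 'a) pre_digraph \<Rightarrow> (('v, 'a) qpath \<Rightarrow>\<^sub>0 'k::field) set \<Rightarrow> bool" where
  "UMP Q I \<longleftrightarrow> (\<forall>a \<in> arcs Q. \<exists>!M. M \<in> maximal_paths Q I \<and>
     (\<exists>m. is_path Q m \<and> residue_class Q I m = M \<and> subpath Q (arrow_path Q a) m))"

end

(*
  Under the hypothesis on nonzero relations, the paths p_j of a nonzero relation cannot be prolonged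
  inside A. Hence a path lies in I iff it contains a zero relation of R as a subpath, and two
  different maximal paths with equal residue class never share an arrow. The statement becomes one
  about words in the arrows that avoid the antichain Z of zero relations, where special
  multiseriality says that "ab is a path outside I" is a partial injection N on the arrows; so a
  word of this kind is determined by any of its letters, its length and the position of the letter.

  If two different maximal words share a letter, then, walking back from it, one of them, m, stops
  while the other continues through an arrow b. So b m is forbidden, and some r in Z is a prefix of
  b m. The other word runs on the cycle u given for r; its own first letter has a predecessor on u,
  which starts a forbidden word on u as well. That word must be r, so both words start with the
  second letter of r.

  Conversely, for r = r_0 r_1 ... in Z with at least three letters, prolonging r_1 r_2 ... to the
  right yields a maximal word m starting with r_1, because r_0 is the only possible predecessor of
  r_1. A maximal word containing r without its last letter also contains r_1, so it is m. Thus r_0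
  occurs in m, and the part of m from r_1 to r_0 is the cycle u. A forbidden word w on u gives in
  the same way a maximal word starting with w_1; it shares an arrow with m, so w_1 = r_1 and w = r.
*)

theory Submission
  imports Defs "HOL-Library.Sublist"
begin

section \<open>Words avoiding a set of forbidden words\<close>

lemma set_mono_sublist: "sublist xs ys \<Longrightarrow> set xs \<subseteq> set ys"
  by (auto simp: sublist_def)

lemma successively_sublist: "successively P ys \<Longrightarrow> sublist xs ys \<Longrightarrow> successively P xs"
  by (auto simp: sublist_def successively_append_iff)

text \<open>\<open>A\<close> is the set of arrows, \<open>C a b\<close> says that \<open>a\<close>
  can be followed by \<open>b\<close>, and \<open>Z\<close> consists of the zero relations read as
  words. \<open>Z_antichain\<close> comes from minimality of the relations,
  \<open>succ_unique\<close> and \<open>pred_unique\<close> are special multiseriality, and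
  \<open>bounded\<close> reflects that a power of the arrow ideal lies in the admissible
  ideal.\<close>

locale special_words =
  fixes A :: "'a set" and C :: "'a \<Rightarrow> 'a \<Rightarrow> bool" and Z :: "'a list set"
  assumes Z_letters: "z \<in> Z \<Longrightarrow> set z \<subseteq> A"
    and Z_comp: "z \<in> Z \<Longrightarrow> successively C z"
    and Z_length: "z \<in> Z \<Longrightarrow> 2 \<le> length z"
    and Z_antichain: "z \<in> Z \<Longrightarrow> z' \<in> Z \<Longrightarrow> sublist z z' \<Longrightarrow> z = z'"
    and succ_unique: "\<lbrakk>a \<in> A; b \<in> A; c \<in> A; C a b; [a, b] \<notin> Z; C a c; [a, c] \<notin> Z\<rbrakk> \<Longrightarrow> b = c"
    and pred_unique: "\<lbrakk>a \<in> A; b \<in> A; c \<in> A; C b a; [b, a] \<notin> Z; C c a; [c, a] \<notin> Z\<rbrakk> \<Longrightarrow> b = c"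
    and bounded: "\<exists>n. \<forall>w. set w \<subseteq> A \<and> successively C w \<and> n \<le> length w \<longrightarrow> (\<exists>z\<in>Z. sublist z w)"
begin

definition N :: "'a \<Rightarrow> 'a \<Rightarrow> bool" where
  "N a b \<longleftrightarrow> a \<in> A \<and> b \<in> A \<and> C a b \<and> [a, b] \<notin> Z"

text \<open>The empty word is excluded because it does not determine the vertex of a stationary
  path.\<close>

definition good :: "'a list \<Rightarrow> bool" where
  "good w \<longleftrightarrow> w \<noteq> [] \<and> set w \<subseteq> A \<and> successively C w \<and> \<not> (\<exists>z\<in>Z. sublist z w)"

definition maximal :: "'a list \<Rightarrow> bool" where
  "maximal m \<longleftrightarrow> good m \<and> (\<forall>a\<in>A. \<not> good (a # m) \<and> \<not> good (m @ [a]))"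

section \<open>Determinism of chains and comparison of maximal words\<close>

lemma N_right_unique: "N a b \<Longrightarrow> N a c \<Longrightarrow> b = c"
  using succ_unique by (auto simp: N_def)

lemma N_left_unique: "N b a \<Longrightarrow> N c a \<Longrightarrow> b = c"
  using pred_unique by (auto simp: N_def)

lemma maximalD: "maximal m \<Longrightarrow> good m" by (simp add: maximal_def)

lemma good_sublist: "good w \<Longrightarrow> sublist v w \<Longrightarrow> v \<noteq> [] \<Longrightarrow> good v"
  unfolding good_def
  by (meson order_trans set_mono_sublist sublist_order.order_trans successively_sublist)

lemma good_singleton: "a \<in> A \<Longrightarrow> good [a]"
  using Z_length by (auto simp: good_def sublist_Cons_right prefix_Cons) fastforce+

text \<open>Only forbidden factors of length two matter, so this also applies to words that need not
  be good, such as long relations and closed cycles.\<close>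

lemma N_chainI:
  assumes "set w \<subseteq> A" "successively C w" "\<And>a b. sublist [a, b] w \<Longrightarrow> [a, b] \<notin> Z"
  shows "successively N w"
  using assms
proof (induction w rule: induct_list012)
  case (3 a b w)
  have "sublist [a, b] (a # b # w)"
    by (simp add: sublist_Cons_right)
  moreover have "[c, d] \<notin> Z" if "sublist [c, d] (b # w)" for c d
    using 3(5) that by (meson sublist_Cons_right)
  ultimately show ?case using 3 by (simp add: N_def)
qed auto

lemma good_chain: "good w \<Longrightarrow> successively N w"
  unfolding good_def by (intro N_chainI) auto

text \<open>\<open>N\<close> allows at most one next letter, so two chains with the same first
  letter agree until one of them stops.\<close>

lemma chain_prefix:
  assumes "successively N v" "successively N w" "v \<noteq> []" "w \<noteq> []" "hd v = hd w"
  shows "prefix v w \<or> prefix w v"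
  using assms
proof (induction v arbitrary: w)
  case (Cons a v)
  then obtain w' where w: "w = a # w'" by (cases w) auto
  show ?case
  proof (cases "v = [] \<or> w' = []")
    case False
    then have "N a (hd v)" "N a (hd w')"
      using Cons.prems w by (auto simp: successively_Cons)
    then have "hd v = hd w'" by (rule N_right_unique)
    with False Cons show ?thesis by (auto simp: w successively_Cons)
  qed (auto simp: w)
qed auto

lemma chain_suffix:
  assumes "successively N v" "successively N w" "v \<noteq> []" "w \<noteq> []" "last v = last w"
  shows "suffix v w \<or> suffix w v"
  using assms
proof (induction v arbitrary: w rule: rev_induct)
  case (snoc a v)
  then obtain w' where w: "w = w' @ [a]" by (cases w rule: rev_cases) auto
  show ?case
  proof (cases "v = [] \<or> w' = []")
    case False
    then have "N (last v) a" "N (last w') a"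
      using snoc.prems w by (auto simp: successively_append_iff)
    then have "last v = last w'" by (rule N_left_unique)
    with False snoc show ?thesis by (auto simp: w successively_append_iff)
  qed (auto simp: w)
qed auto

lemma maximal_not_strict_prefix:
  assumes "maximal m" "good m'" "prefix m m'"
  shows "m = m'"
proof (rule ccontr)
  assume "m \<noteq> m'"
  then obtain c v where v: "m' = m @ c # v"
    using assms(3) by (metis append_Nil2 list.exhaust prefixE)
  then have "sublist (m @ [c]) m'" by (simp add: sublist_def) (metis append_Nil)
  then have "good (m @ [c])" using assms(2) good_sublist by blast
  moreover have "c \<in> A" using assms(2) v by (auto simp: good_def)
  ultimately show False using assms(1) by (auto simp: maximal_def)
qed

text \<open>The two chains are comparable by \<open>chain_prefix\<close>, and a maximal word is
  never a strict prefix of a good one.\<close>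

lemma maximal_hd_eq:
  assumes "maximal m" "maximal m'" "hd m = hd m'"
  shows "m = m'"
  using chain_prefix[of m m'] assms maximal_not_strict_prefix maximalD good_chain
  by (metis good_def)

text \<open>Walking back from a common letter, one of two maximal words runs out first.\<close>

lemma maximal_cases:
  assumes m: "maximal m" and m': "maximal m'" and a: "a \<in> set m" "a \<in> set m'"
  obtains (eq) "m = m'"
    | (left) b where "N b (hd m)" "b \<in> set m'"
    | (right) b where "N b (hd m')" "b \<in> set m"
proof -
  obtain x y where x: "m = x @ a # y" using a(1) by (meson split_list)
  obtain x' y' where x': "m' = x' @ a # y'" using a(2) by (meson split_list)
  have c: "successively N ((x @ [a]) @ y)" "successively N ((x' @ [a]) @ y')"
    using m m' good_chain maximalD x x' by fastforce+
  then have c1: "successively N (x @ [a])" "successively N (x' @ [a])"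
    by (simp_all only: successively_append_iff)
  have "suffix (x @ [a]) (x' @ [a]) \<or> suffix (x' @ [a]) (x @ [a])"
    by (rule chain_suffix[OF c1]) auto
  \<comment> \<open>Stated for \<open>v\<close> and \<open>v'\<close> so that one argument serves
    both orders: \<open>v\<close> precedes \<open>a\<close> in the word that runs out first, and the
    other word has the surplus \<open>t\<close> in front of it.\<close>
  moreover have *: thesis
    if "suffix (v @ [a]) (v' @ [a])" "(v = x \<and> v' = x') \<or> (v = x' \<and> v' = x)" for v v'
  proof -
    have "suffix v v'" using that(1) by simp
    then obtain t where t: "v' = t @ v" by (rule suffixE)
    show thesis
    proof (cases "t = []")
      case True
      then have "hd m = hd m'" using that(2) t x x' by (auto simp: hd_append)
      then show thesis using maximal_hd_eq[OF m m'] eq by blast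
    next
      \<comment> \<open>The maximal word that runs out first begins like \<open>v @ [a]\<close>, so
        the last letter of \<open>t\<close> is an \<open>N\<close>-predecessor of its first
        letter.\<close>
      case False
      have "successively N (t @ (v @ [a]))" using c1 t that(2) by auto
      then have "N (last t) (hd (v @ [a]))"
        using False by (simp only: successively_append_iff) auto
      moreover have "last t \<in> set v'" using False t by simp
      ultimately show thesis
        using that(2) x x' left right by (auto simp: hd_append split: if_splits)
    qed
  qed
  ultimately show thesis by blast
qed

lemma maximal_eq_if_no_pred:
  assumes "maximal m" "maximal m'" "a \<in> set m" "a \<in> set m'"
    and "\<And>b. \<not> N b (hd m)" "\<And>b. \<not> N b (hd m')"
  shows "m = m'"
  using maximal_cases[OF assms(1-4)] assms(5,6) by metis

section \<open>Extension to maximal words\<close>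

lemma good_length:
  obtains n where "\<And>w. good w \<Longrightarrow> length w < n"
proof -
  obtain n where
    n: "\<forall>w. set w \<subseteq> A \<and> successively C w \<and> n \<le> length w \<longrightarrow> (\<exists>z\<in>Z. sublist z w)"
    using bounded by (rule exE)
  have "length w < n" if "good w" for w
  proof (rule ccontr)
    assume "\<not> length w < n"
    with that n[rule_format, of w] show False by (auto simp: good_def)
  qed
  then show thesis by (rule that)
qed

text \<open>Extending on the right only keeps the first letter of \<open>w\<close>, which
  \<open>good_extend\<close> does not guarantee.\<close>

lemma good_extend_right:
  assumes "good w"
  obtains v where "good (w @ v)" "\<And>a. \<not> good (w @ v @ [a])"
proof -
  obtain n where n: "\<And>w. good w \<Longrightarrow> length w < n" using good_length by blast
  have "\<exists>v. good (w @ v) \<and> (\<forall>v'. good (w @ v') \<longrightarrow> length v' \<le> length v)"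
  proof (rule ex_has_greatest_nat[where k = "[]" and b = n])
    show "\<forall>v. good (w @ v) \<longrightarrow> length v < n"
      using n by fastforce
  qed (use assms in simp)
  then obtain v where "good (w @ v)" "\<And>v'. good (w @ v') \<Longrightarrow> length v' \<le> length v" by blast
  then show thesis using that[of v] by fastforce
qed

lemma good_extend:
  assumes "good w"
  obtains m where "maximal m" "sublist w m"
proof -
  obtain n where n: "\<And>w. good w \<Longrightarrow> length w < n" using good_length by blast
  have "\<exists>m. (good m \<and> sublist w m) \<and> (\<forall>m'. good m' \<and> sublist w m' \<longrightarrow> length m' \<le> length m)"
  proof (rule ex_has_greatest_nat[where k = w and b = n])
    show "\<forall>v. good v \<and> sublist w v \<longrightarrow> length v < n"
      using n by blast
  qed (use assms in simp)
  then obtain m where m: "good m" "sublist w m"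
    and le: "\<And>m'. good m' \<Longrightarrow> sublist w m' \<Longrightarrow> length m' \<le> length m" by blast
  have "\<not> good (a # m)" "\<not> good (m @ [a])" for a
    using le[of "a # m"] le[of "m @ [a]"] m(2)
    by (auto simp: sublist_Cons_right sublist_append)
  then have "maximal m" using m(1) by (simp add: maximal_def)
  then show thesis using that m(2) by blast
qed

text \<open>As \<open>m\<close> is good, a forbidden factor of \<open>b # m\<close> has to begin at
  \<open>b\<close>; it has more than two letters because \<open>N b (hd m)\<close> permits the pair
  at the front.\<close>

lemma blocked_pred:
  assumes "maximal m" "N b (hd m)"
  obtains r where "r \<in> Z" "2 < length r" "hd r = b" "prefix r (b # m)"
proof -
  from assms have "good m" "b \<in> A" and Nb: "[b, hd m] \<notin> Z" "C b (hd m)" and ng: "\<not> good (b # m)"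
    by (auto simp: maximal_def N_def)
  have "m \<noteq> []" using \<open>good m\<close> by (simp add: good_def)
  have "\<exists>z\<in>Z. sublist z (b # m)"
    using ng \<open>good m\<close> \<open>b \<in> A\<close> Nb by (auto simp: good_def successively_Cons)
  then obtain r where r: "r \<in> Z" "sublist r (b # m)" by blast
  moreover have "\<not> sublist r m" using \<open>good m\<close> r by (auto simp: good_def)
  ultimately have p: "prefix r (b # m)" by (auto simp: sublist_Cons_right)
  have "2 \<le> length r" using r Z_length by blast
  then obtain c d r' where c: "r = c # d # r'" by (cases r; cases "tl r") auto
  then have "c = b" "d = hd m" using p \<open>m \<noteq> []\<close> by (cases m; auto)+
  then have "r' \<noteq> []" using Nb r c by auto
  then show thesis using that r p c \<open>c = b\<close> by simp
qed

section \<open>Cycles and the words lying on them\<close>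

text \<open>Appending \<open>hd u\<close> subjects the closing step, from the last letter back to
  the first, to the same condition as the others.\<close>

definition cycle :: "'a list \<Rightarrow> bool" where
  "cycle u \<longleftrightarrow> u \<noteq> [] \<and> successively N (u @ [hd u])"

abbreviation pow :: "'a list \<Rightarrow> nat \<Rightarrow> 'a list" where
  "pow u p \<equiv> concat (replicate p u)"

lemma hd_pow: "u \<noteq> [] \<Longrightarrow> 0 < p \<Longrightarrow> hd (pow u p) = hd u"
  by (cases p) auto

lemma cycle_pow_chain: "cycle u \<Longrightarrow> successively N (pow u p)"
proof (induction p)
  case (Suc p)
  then show ?case
    by (cases "p = 0") (auto simp: cycle_def successively_append_iff hd_pow)
qed auto

lemma cycle_ex_pred:
  assumes "cycle u" "b \<in> set u"
  shows "\<exists>a\<in>set u. N a b"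
proof -
  obtain ys zs where u: "u = ys @ b # zs" using assms(2) by (meson split_list)
  show ?thesis
  proof (cases "ys = []")
    case True
    then have "N (last u) b" using assms(1) u unfolding cycle_def
      by (simp only: successively_append_iff) auto
    moreover have "last u \<in> set u" using u by simp
    ultimately show ?thesis by blast
  next
    case False
    then have "N (last ys) b" using assms(1) u by (auto simp: cycle_def successively_append_iff)
    moreover have "last ys \<in> set u" using u False by simp
    ultimately show ?thesis by blast
  qed
qed

lemma cycle_pred: "cycle u \<Longrightarrow> b \<in> set u \<Longrightarrow> N a b \<Longrightarrow> a \<in> set u"
  using cycle_ex_pred N_left_unique by blast

text \<open>\<open>N\<close>-predecessors are unique and the cycle supplies one for each of its
  letters, so walking backwards never leaves the cycle.\<close>

lemma chain_hd_in_cycle: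
  assumes "cycle u" "successively N w" "a \<in> set w" "a \<in> set u"
  shows "hd w \<in> set u"
  using assms(2,3)
proof (induction w)
  case (Cons b w)
  show ?case
  proof (cases "w = [] \<or> a = b")
    case False
    then have "hd w \<in> set u" "N b (hd w)" using Cons by (auto simp: successively_Cons)
    then show ?thesis using cycle_pred assms(1) by auto
  qed (use Cons assms(4) in auto)
qed auto

text \<open>The first letter lies on the cycle by \<open>chain_hd_in_cycle\<close>; from there
  uniqueness of successors forces \<open>w\<close> to follow the cycle.\<close>

lemma chain_on_cycle:
  assumes "cycle u" "successively N w" "a \<in> set w" "a \<in> set u"
  obtains p where "1 \<le> p" "sublist w (pow u p)"
proof -
  have "w \<noteq> []" using assms(3) by auto
  have "hd w \<in> set u" using chain_hd_in_cycle assms by blast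
  then obtain ys zs where u: "u = ys @ hd w # zs" by (meson split_list)
  \<comment> \<open>\<open>v\<close> is the walk along the cycle starting at \<open>hd w\<close>,
    with \<open>length w\<close> further turns so that it is longer than \<open>w\<close>.\<close>
  define v where "v = hd w # zs @ pow u (length w)"
  have pw: "pow u (Suc (length w)) = ys @ v" by (simp add: v_def) (subst u, simp)
  have "u \<noteq> []" using assms(1) by (simp add: cycle_def)
  have len: "n \<le> length (pow u n)" for n
  proof (induction n)
    case (Suc n)
    moreover have "1 \<le> length u" using \<open>u \<noteq> []\<close> by (cases u) auto
    ultimately show ?case by simp
  qed simp
  have "successively N v"
    using cycle_pow_chain[OF assms(1), of "Suc (length w)"] unfolding pw
    by (simp add: successively_append_iff)
  then have "prefix w v \<or> prefix v w"
    by (intro chain_prefix) (use assms \<open>w \<noteq> []\<close> in \<open>auto simp: v_def\<close>)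
  moreover have "length w < length v" using len[of "length w"] by (simp add: v_def)
  ultimately have "prefix w v" using prefix_length_le by fastforce
  then have "sublist w (ys @ v)" by (auto simp: prefix_def sublist_def)
  then show thesis using that[of "Suc (length w)"] pw by simp
qed

definition on_cycle :: "'a list \<Rightarrow> 'a list set" where
  "on_cycle u = {w. \<exists>p\<ge>1. sublist w (pow u p)}"

lemma set_on_cycle: "w \<in> on_cycle u \<Longrightarrow> set w \<subseteq> set u"
  by (auto simp: on_cycle_def dest!: set_mono_sublist)

lemma on_cycle_chain:
  assumes "cycle u" "w \<in> on_cycle u"
  shows "successively N w"
  using assms successively_sublist cycle_pow_chain by (fastforce simp: on_cycle_def)

text \<open>\<open>u @ [hd u]\<close> is a prefix of the second power; this makes the pair that
  closes the cycle visible to \<open>on_cycle\<close>.\<close>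

lemma sublist_append_hd_pow:
  assumes "u \<noteq> []" "sublist w (u @ [hd u])"
  shows "w \<in> on_cycle u"
proof -
  obtain c t where "u = c # t" using assms(1) by (cases u) auto
  then have "prefix (u @ [hd u]) (pow u 2)" by (simp add: numeral_2_eq_2)
  then show ?thesis using assms(2) unfolding on_cycle_def
    by (metis (mono_tags, lifting) mem_Collect_eq one_le_numeral prefix_imp_sublist
        sublist_order.order_trans)
qed

section \<open>The equivalence for words\<close>

theorem unique_maximal_iff:
  "(\<forall>a\<in>A. \<exists>!m. maximal m \<and> a \<in> set m) \<longleftrightarrow>
   (\<forall>r\<in>Z. 2 < length r \<longrightarrow>
      (\<exists>u. u \<noteq> [] \<and> set u \<subseteq> A \<and> successively C (u @ [hd u]) \<and> Z \<inter> on_cycle u = {r}))"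
  (is "?U = ?V")
proof
  assume V: ?V
  \<comment> \<open>This excludes the last two cases of \<open>maximal_cases\<close>; the
    contradiction will be that \<open>m\<close> and \<open>m'\<close> begin with the same
    letter.\<close>
  have no_pred: False
    if m: "maximal m" and m': "maximal m'" and b: "N b (hd m)" "b \<in> set m'" and "m \<noteq> m'" for m m' b
  proof -
    obtain r where r: "r \<in> Z" "2 < length r" "hd r = b" using blocked_pred[OF m b(1)] by metis
    then obtain u where u: "u \<noteq> []" "set u \<subseteq> A" "successively C (u @ [hd u])"
      and ur: "Z \<inter> on_cycle u = {r}" using V r(1,2) by (metis (no_types, lifting))
    \<comment> \<open>A forbidden pair on \<open>u\<close> would have to be \<open>r\<close>, which
      is longer; hence the given \<open>u\<close> is a cycle for \<open>N\<close>.\<close>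
    have nz: "[c, d] \<notin> Z" if "sublist [c, d] (u @ [hd u])" for c d
    proof
      assume "[c, d] \<in> Z"
      then have "[c, d] = r" using sublist_append_hd_pow[OF u(1) that] ur by blast
      then show False using r(2) by auto
    qed
    have "successively N (u @ [hd u])"
      by (rule N_chainI) (use u nz in auto)
    then have "cycle u" using u(1) by (simp add: cycle_def)
    have "b \<in> set u"
      using r set_on_cycle[of r u] ur
      by (metis Int_iff hd_in_set insertI1 list.size(3) not_less_zero subsetD)
    then have "hd m' \<in> set u"
      using chain_hd_in_cycle[OF \<open>cycle u\<close> good_chain] m' b(2) by (auto simp: maximal_def)
    \<comment> \<open>Now \<open>m'\<close> is blocked too, by a relation \<open>r'\<close> that
      begins on \<open>u\<close> and therefore runs along \<open>u\<close> entirely.\<close>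
    obtain b' where b': "N b' (hd m')"
      using cycle_ex_pred[OF \<open>cycle u\<close> \<open>hd m' \<in> set u\<close>] by blast
    obtain r' where r': "r' \<in> Z" "hd r' = b'" "prefix r' (b' # m')" "2 < length r'"
      using blocked_pred[OF m' b'] by metis
    have "b' \<in> set u" using cycle_pred[OF \<open>cycle u\<close> \<open>hd m' \<in> set u\<close> b'] .
    have "m' \<noteq> []" "successively N m'" using m' good_chain by (auto simp: maximal_def good_def)
    then have "successively N (b' # m')" using b' by (auto simp: successively_Cons)
    then have "successively N r'" using r'(3) successively_sublist prefix_imp_sublist by blast
    moreover have "b' \<in> set r'" using r'(2,4) by (cases r') auto
    ultimately have "r' \<in> on_cycle u"
      using chain_on_cycle[OF \<open>cycle u\<close> _ _ \<open>b' \<in> set u\<close>] by (auto simp: on_cycle_def)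
    then have "r' = r" using ur r' by blast
    \<comment> \<open>Since \<open>r' = r\<close>, the letters \<open>b\<close> and
      \<open>b'\<close> agree, and this letter has only one \<open>N\<close>-successor.\<close>
    then have "hd m = hd m'" using r r' b b' N_right_unique by metis
    then show False using maximal_hd_eq m m' \<open>m \<noteq> m'\<close> by blast
  qed
  show ?U
  proof
    fix a assume "a \<in> A"
    then obtain m where "maximal m" "sublist [a] m" using good_extend[OF good_singleton] by metis
    then have "maximal m \<and> a \<in> set m" by (auto dest: set_mono_sublist)
    moreover have "m = m'" if "maximal m \<and> a \<in> set m" "maximal m' \<and> a \<in> set m'" for m m'
      using maximal_cases[of m m' a] no_pred[of m m'] no_pred[of m' m] that by metis
    ultimately show "\<exists>!m. maximal m \<and> a \<in> set m" by blast
  qed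
next
  assume U: ?U
  have uniq: "m = m'" if "maximal m" "maximal m'" "a \<in> set m" "a \<in> set m'" for m m' a
  proof -
    have "a \<in> A" using that by (auto simp: maximal_def good_def)
    then show ?thesis using U that by blast
  qed
  \<comment> \<open>By the antichain property a relation with more than two letters contains no
    forbidden pair.\<close>
  have chainZ: "successively N z" if z: "z \<in> Z" "2 < length z" for z
  proof (rule N_chainI)
    show "[a, b] \<notin> Z" if "sublist [a, b] z" for a b
      using Z_antichain[OF _ z(1) that] z by auto
  qed (use z Z_letters Z_comp in auto)
  have properZ: "good v" if "z \<in> Z" "sublist v z" "v \<noteq> z" "v \<noteq> []" for v z
    unfolding good_def
    using that Z_letters Z_comp set_mono_sublist successively_sublist Z_antichain
    by (metis order_trans sublist_order.order_antisym sublist_order.order_trans)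
  have start: "\<exists>m. maximal m \<and> hd m = z ! 1" if z: "z \<in> Z" "2 < length z" for z
  proof -
    obtain a b t where abt: "z = a # b # t" using z(2) by (cases z; cases "tl z") auto
    have "good (b # t)" using properZ[OF z(1)] abt by (simp add: sublist_Cons_right)
    then obtain v where v: "good ((b # t) @ v)" "\<And>c. \<not> good ((b # t) @ v @ [c])"
      using good_extend_right by blast
    have "N a b" using chainZ[OF z] abt by simp
    \<comment> \<open>A good extension forces \<open>c = a\<close>, the only
      \<open>N\<close>-predecessor of \<open>b\<close>, and then \<open>z\<close> itself reappears
      as a prefix.\<close>
    have "\<not> good (c # (b # t) @ v)" for c
    proof
      assume g: "good (c # (b # t) @ v)"
      then have "N c b" using good_chain by fastforce
      then have "c = a" using \<open>N a b\<close> N_left_unique by blast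
      then have "sublist z (c # (b # t) @ v)"
        using abt by (metis append_Cons prefix_def prefix_imp_sublist)
      then show False using g z by (auto simp: good_def)
    qed
    then have "maximal ((b # t) @ v)" using v by (simp add: maximal_def)
    then show ?thesis using abt by (intro exI[of _ "(b # t) @ v"]) auto
  qed
  show ?V
  proof (intro ballI impI)
    fix r assume r: "r \<in> Z" "2 < length r"
    obtain m where m: "maximal m" "hd m = r ! 1" using start[OF r] by blast
    obtain a b c t where abt: "r = a # b # c # t"
      using r(2) by (cases r; cases "tl r"; cases "tl (tl r)") auto
    have "N a b" using chainZ[OF r] abt by simp
    have hdm: "hd m = b" "m \<noteq> []" using m abt by (auto simp: maximal_def good_def)
    \<comment> \<open>With at least three letters in \<open>r\<close>, the word
      \<open>butlast r\<close> still contains \<open>a\<close> and \<open>b\<close>. Its maximal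
      extension shares \<open>b\<close> with \<open>m\<close>, hence equals \<open>m\<close>, so
      \<open>a\<close> occurs in \<open>m\<close>.\<close>
    have "length (butlast r) \<noteq> length r" by (simp add: abt)
    then have "butlast r \<noteq> r" by metis
    moreover have "sublist (butlast r) r" by (rule prefix_imp_sublist[OF prefixeq_butlast])
    moreover have "butlast r \<noteq> []" by (simp add: abt)
    ultimately have "good (butlast r)" using properZ r(1) by blast
    then obtain m' where m': "maximal m'" "sublist (butlast r) m'" using good_extend by blast
    have "a \<in> set m'" "b \<in> set m'" using m'(2)[THEN set_mono_sublist] abt by auto
    then have "m' = m" using uniq[OF m'(1) m(1)] hdm by (metis hd_in_set)
    then have "a \<in> set m" using \<open>a \<in> set m'\<close> by simp
    then obtain x y where xy: "m = x @ a # y" by (meson split_list)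
    \<comment> \<open>The stretch of \<open>m\<close> from its first letter \<open>b\<close> up to
      an occurrence of \<open>a\<close>; the step \<open>N a b\<close> closes it.\<close>
    define u where "u = x @ [a]"
    have "hd u = b" using hdm xy by (cases x) (auto simp: u_def)
    have "cycle u" unfolding cycle_def
      using good_chain[OF maximalD[OF m(1)]] \<open>N a b\<close> xy \<open>hd u = b\<close>
      by (auto simp: u_def successively_append_iff)
    have "a \<in> set u" by (simp add: u_def)
    have "r \<in> on_cycle u"
      using chain_on_cycle[OF \<open>cycle u\<close> chainZ[OF r] _ \<open>a \<in> set u\<close>] abt
      by (auto simp: on_cycle_def)
    moreover have "w = r" if w: "w \<in> Z" "w \<in> on_cycle u" for w
    proof -
      have Nw: "successively N w" using on_cycle_chain \<open>cycle u\<close> w by blast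
      have "2 < length w"
      proof (rule ccontr)
        assume "\<not> 2 < length w"
        then have "length w = 2" using Z_length[OF w(1)] by simp
        then obtain c d where "w = [c, d]" by (auto simp: length_Suc_conv numeral_2_eq_2)
        then show False using Nw w by (simp add: N_def)
      qed
      then obtain a' b' t' where w': "w = a' # b' # t'" by (cases w; cases "tl w") auto
      \<comment> \<open>\<open>start\<close> turns \<open>w\<close> into a maximal word beginning
        with \<open>b'\<close>; as \<open>b'\<close> also occurs in \<open>m\<close>, uniqueness
        gives \<open>n = m\<close> and so \<open>b' = b\<close>.\<close>
      obtain n where n: "maximal n" "hd n = b'" using start[OF w(1) \<open>2 < length w\<close>] w' by auto
      have "b' \<in> set u" using set_on_cycle[OF w(2)] w' by auto
      then have "b' \<in> set m" by (auto simp: u_def xy)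
      moreover have "b' \<in> set n" using n by (metis good_def hd_in_set maximal_def)
      ultimately have "n = m" using uniq n m by blast
      then have "b' = b" using n hdm by simp
      then have "a' = a" using Nw w' \<open>N a b\<close> N_left_unique by auto
      \<comment> \<open>Equal first letters make \<open>w\<close> and \<open>r\<close> comparable as
        chains; the antichain property then makes them equal.\<close>
      have "prefix w r \<or> prefix r w"
        by (rule chain_prefix[OF Nw chainZ[OF r]]) (use w' abt \<open>a' = a\<close> in auto)
      then show ?thesis using Z_antichain w r prefix_imp_sublist by metis
    qed
    ultimately have "Z \<inter> on_cycle u = {r}" using r by blast
    moreover have "successively C (u @ [hd u])" "set u \<subseteq> A"
    proof -
      show "successively C (u @ [hd u])"
        using \<open>cycle u\<close> unfolding cycle_def by (auto elim!: successively_mono simp: N_def)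
      show "set u \<subseteq> A" using m xy by (auto simp: u_def maximal_def good_def)
    qed
    ultimately show "\<exists>u. u \<noteq> [] \<and> set u \<subseteq> A \<and> successively C (u @ [hd u]) \<and> Z \<inter> on_cycle u = {r}"
      using \<open>cycle u\<close> by (auto simp: cycle_def)
  qed
qed

end


section \<open>Paths as words\<close>

lemma path_elt_mult:
  "path_elt p \<otimes>\<^bsub>path_algebra Q\<^esub> path_elt q = (if tgt p = src q then path_elt (path_comp p q) else 0)"
  by (simp add: path_algebra_mult_single basis_mult_def)

lemma path_algebra_add_zero [simp]:
  "f \<oplus>\<^bsub>path_algebra Q\<^esub> g = f + g" "\<zero>\<^bsub>path_algebra Q\<^esub> = 0"
  by (simp_all add: path_algebra_def)

lemma path_elt_eq_iff [simp]: "(path_elt p :: _ \<Rightarrow>\<^sub>0 'k::field) = path_elt q \<longleftrightarrow> p = q"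
  by (metis keys_single singleton_inject zero_neq_one)

lemma mem_carrier_path_algebra:
  "f \<in> carrier (path_algebra Q) \<longleftrightarrow> (\<forall>p\<in>Poly_Mapping.keys f. is_path Q p)"
  by (simp add: path_algebra_def)

lemma keys_path_algebra_mult:
  assumes "r \<in> Poly_Mapping.keys (f \<otimes>\<^bsub>path_algebra Q\<^esub> g)"
  obtains p q where "p \<in> Poly_Mapping.keys f" "q \<in> Poly_Mapping.keys g" "tgt p = src q"
    "r = path_comp p q"
proof -
  have "f \<otimes>\<^bsub>path_algebra Q\<^esub> g = (\<Sum>p \<in> Poly_Mapping.keys f. \<Sum>q \<in> Poly_Mapping.keys g.
      basis_mult p q (Poly_Mapping.lookup f p * Poly_Mapping.lookup g q))"
    by (simp add: path_algebra_def)
  with assms have "r \<in> Poly_Mapping.keys (\<Sum>p \<in> Poly_Mapping.keys f. \<Sum>q \<in> Poly_Mapping.keys g.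
      basis_mult p q (Poly_Mapping.lookup f p * Poly_Mapping.lookup g q))"
    by simp
  from subsetD[OF keys_sum this] obtain p where p: "p \<in> Poly_Mapping.keys f"
    and r: "r \<in> Poly_Mapping.keys (\<Sum>q \<in> Poly_Mapping.keys g.
      basis_mult p q (Poly_Mapping.lookup f p * Poly_Mapping.lookup g q))"
    by blast
  from subsetD[OF keys_sum r] obtain q where "q \<in> Poly_Mapping.keys g"
    and "r \<in> Poly_Mapping.keys (basis_mult p q (Poly_Mapping.lookup f p * Poly_Mapping.lookup g q))"
    by blast
  note p this
  then show thesis using that by (auto simp: basis_mult_def split: if_splits)
qed

text \<open>The end points are recovered from the letters; for the empty word they are
  arbitrary.\<close>

definition word_path :: "('v, 'a) pre_digraph \<Rightarrow> 'a list \<Rightarrow> ('v, 'a) qpath" where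
  "word_path Q w = Path (tail Q (hd w)) w (head Q (last w))"

abbreviation composable :: "('v, 'a) pre_digraph \<Rightarrow> 'a \<Rightarrow> 'a \<Rightarrow> bool" where
  "composable Q a b \<equiv> head Q a = tail Q b"

lemma word_path_simps [simp]:
  "src (word_path Q w) = tail Q (hd w)" "tgt (word_path Q w) = head Q (last w)"
  "arrows (word_path Q w) = w"
  by (simp_all add: word_path_def)

lemma inj_word_path: "inj (word_path Q)"
  by (metis injI word_path_simps(3))

lemma arrows_path_power [simp]: "arrows (path_power u p) = concat (replicate p (arrows u))"
  by (induction p) auto

context wf_digraph
begin

lemma cas_iff_chain:
  "w \<noteq> [] \<Longrightarrow> cas u w v \<longleftrightarrow>
     successively (composable G) w \<and> u = tail G (hd w) \<and> v = head G (last w)"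
proof (induction w arbitrary: u)
  case (Cons a w)
  then show ?case by (cases "w = []") (auto simp: successively_Cons)
qed simp

lemma is_path_iff:
  assumes "w \<noteq> []"
  shows "is_path G (Path u w v) \<longleftrightarrow> set w \<subseteq> arcs G \<and> successively (composable G) w \<and>
    u = tail G (hd w) \<and> v = head G (last w)"
proof -
  have "tail G (hd w) \<in> verts G" if "set w \<subseteq> arcs G"
    using that assms by (intro tail_in_verts) auto
  then show ?thesis
    using assms by (auto simp: is_path_def awalk_def cas_iff_chain)
qed

lemma is_path_word_path:
  "w \<noteq> [] \<Longrightarrow> is_path G (word_path G w) \<longleftrightarrow> set w \<subseteq> arcs G \<and> successively (composable G) w"
  by (simp add: word_path_def is_path_iff)

lemma path_eq_word_path: "is_path G p \<Longrightarrow> arrows p \<noteq> [] \<Longrightarrow> p = word_path G (arrows p)"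
  by (cases p) (auto simp: word_path_def is_path_iff)

lemma path_power_is_path:
  assumes "is_path G u" "tgt u = src u"
  shows "is_path G (path_power u p) \<and> src (path_power u p) = src u \<and> tgt (path_power u p) = src u"
  using assms by (induction p) (auto simp: is_path_src is_path_comp)

text \<open>A nonempty word fixes its end points, so splitting the word splits the path. The empty
  word occurs in every word, whereas a stationary path need not lie on the path in question.\<close>

lemma subpath_iff_sublist:
  assumes "is_path G p" "is_path G q" "arrows p \<noteq> []"
  shows "subpath G p q \<longleftrightarrow> sublist (arrows p) (arrows q)"
proof
  assume "sublist (arrows p) (arrows q)"
  then obtain x y where xy: "arrows q = x @ arrows p @ y" by (auto simp: sublist_def)
  have "awalk (src q) (x @ arrows p @ y) (tgt q)"
    using assms(2) by (simp add: is_path_def flip: xy)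
  then obtain v v' where v: "awalk (src q) x v" "awalk v (arrows p) v'" "awalk v' y (tgt q)"
    by (metis awalk_append_iff)
  then have "v = src p" "v' = tgt p"
    using assms(1,3) by (auto simp: is_path_def awalk_def cas_iff_chain)
  with v xy assms(1) show "subpath G p q" unfolding subpath_def
    by (intro conjI exI[of _ "Path (src q) x v"] exI[of _ "Path v' y (tgt q)"])
      (simp_all add: is_path_def path_comp_def flip: xy)
qed (force simp: subpath_def sublist_def)

lemma subpath_comp_left:
  assumes "subpath G s q" "is_path G p" "tgt p = src q"
  shows "subpath G s (path_comp p q)"
proof -
  from assms(1) obtain x y where xy: "is_path G s" "is_path G x" "is_path G y"
    "tgt x = src s" "tgt s = src y" "q = path_comp x (path_comp s y)"
    unfolding subpath_def by blast
  then have "is_path G (path_comp p x)" using assms by (simp add: is_path_comp)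
  moreover have "path_comp p q = path_comp (path_comp p x) (path_comp s y)"
    by (simp add: xy path_comp_assoc)
  ultimately show ?thesis unfolding subpath_def using xy by (metis path_comp_simps(2))
qed

lemma subpath_comp_right:
  assumes "subpath G s q" "is_path G p" "tgt q = src p"
  shows "subpath G s (path_comp q p)"
proof -
  from assms(1) obtain x y where xy: "is_path G s" "is_path G x" "is_path G y"
    "tgt x = src s" "tgt s = src y" "q = path_comp x (path_comp s y)"
    unfolding subpath_def by blast
  then have "is_path G (path_comp y p)" using assms by (simp add: is_path_comp)
  moreover have "path_comp q p = path_comp x (path_comp s (path_comp y p))"
    by (simp add: xy path_comp_assoc)
  ultimately show ?thesis unfolding subpath_def using xy by (metis path_comp_simps(1))
qed

section \<open>Monomial ideals and powers of the arrow ideal\<close>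

text \<open>The monomial ideal spanned by the paths that contain a member of \<open>S\<close>; it
  bounds from above any ideal generated by elements whose keys lie in it.\<close>

lemma subpath_keys_ideal:
  assumes "fin_digraph G"
  shows "ideal {f \<in> carrier (path_algebra G :: (('a, 'b) qpath \<Rightarrow>\<^sub>0 'k::field) ring).
      \<forall>q\<in>Poly_Mapping.keys f. \<exists>s\<in>S. subpath G s q} (path_algebra G)"
  (is "ideal ?J ?K")
proof -
  interpret fin_digraph G by fact
  interpret K: ring ?K by (rule path_algebra_ring)
  show ?thesis
  proof (rule idealI)
    show "subgroup ?J (add_monoid ?K)"
    proof (rule K.add.subgroupI)
      have "0 \<in> ?J" by (simp add: mem_carrier_path_algebra)
      then show "?J \<noteq> {}" by blast
      show "\<ominus>\<^bsub>?K\<^esub> f \<in> ?J" if "f \<in> ?J" for f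
      proof -
        have "\<ominus>\<^bsub>?K\<^esub> f = - f"
          by (rule K.minus_equality) (use that in \<open>simp_all add: mem_carrier_path_algebra\<close>)
        then show ?thesis
          using that by (simp add: mem_carrier_path_algebra)
      qed
      show "f \<oplus>\<^bsub>?K\<^esub> g \<in> ?J" if "f \<in> ?J" "g \<in> ?J" for f g
        using that Poly_Mapping.keys_add[of f g] by (simp add: mem_carrier_path_algebra) blast
    qed (simp add: subset_iff)
    fix f g assume f: "f \<in> ?J" and g: "g \<in> carrier ?K"
    have "\<exists>s\<in>S. subpath G s r" if "r \<in> Poly_Mapping.keys (g \<otimes>\<^bsub>?K\<^esub> f)" for r
      using that
    proof (rule keys_path_algebra_mult)
      fix p q assume *: "p \<in> Poly_Mapping.keys g" "q \<in> Poly_Mapping.keys f" "tgt p = src q"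
        "r = path_comp p q"
      then have "is_path G p" "\<exists>s\<in>S. subpath G s q"
        using f g by (auto simp only: mem_carrier_path_algebra mem_Collect_eq)
      then show ?thesis using * subpath_comp_left by blast
    qed
    then show "g \<otimes>\<^bsub>?K\<^esub> f \<in> ?J" using f g K.m_closed by blast
    have "\<exists>s\<in>S. subpath G s r" if "r \<in> Poly_Mapping.keys (f \<otimes>\<^bsub>?K\<^esub> g)" for r
      using that
    proof (rule keys_path_algebra_mult)
      fix q p assume *: "q \<in> Poly_Mapping.keys f" "p \<in> Poly_Mapping.keys g" "tgt q = src p"
        "r = path_comp q p"
      then have "is_path G p" "\<exists>s\<in>S. subpath G s q"
        using f g by (auto simp only: mem_carrier_path_algebra mem_Collect_eq)
      then show ?thesis using * subpath_comp_right by blast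
    qed
    then show "f \<otimes>\<^bsub>?K\<^esub> g \<in> ?J" using f g K.m_closed by blast
  qed (rule path_algebra_ring)
qed

end

text \<open>The last arrow is peeled off. For length zero the power is the unit of the monoid of
  ideals, the whole path algebra.\<close>

lemma (in fin_digraph) path_elt_mem_arrow_ideal_pow:
  assumes "is_path G p"
  shows "(path_elt p :: _ \<Rightarrow>\<^sub>0 'k::field)
    \<in> arrow_ideal G [^]\<^bsub>ideals_set (path_algebra G)\<^esub> (path_length p)"
  using assms
proof (induction "path_length p" arbitrary: p)
  case 0
  have "is_path G p" by fact
  then show ?case unfolding 0(1)[symmetric] nat_pow_0
    by (simp add: ideals_set_def mem_carrier_path_algebra)
next
  case (Suc n)
  interpret K: ring "path_algebra G :: (_ \<Rightarrow>\<^sub>0 'k) ring" by (rule path_algebra_ring)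
  obtain w a where wa: "arrows p = w @ [a]" using Suc(2) by (cases "arrows p" rule: rev_cases) auto
  have "awalk (src p) (w @ [a]) (tgt p)" using Suc(3) wa by (simp add: is_path_def)
  then have "awalk (src p) w (tail G a)" "a \<in> arcs G" "tgt p = head G a"
    unfolding awalk_append_iff awalk_Cons_iff awalk_Nil_iff by auto
  moreover define p' where "p' = Path (src p) w (tail G a)"
  ultimately have p': "is_path G p'" "tgt p' = tail G a" "p = path_comp p' (arrow_path G a)"
    using wa by (cases p; auto simp: is_path_def arrow_path_def path_comp_def)+
  have "path_elt p = path_elt p' \<otimes>\<^bsub>path_algebra G\<^esub> (arrow_elt G a :: _ \<Rightarrow>\<^sub>0 'k)"
    using p' by (simp add: path_elt_mult arrow_path_def)
  moreover have "(arrow_elt G a :: _ \<Rightarrow>\<^sub>0 'k) \<in> arrow_ideal G" unfolding arrow_ideal_def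
    using \<open>a \<in> arcs G\<close>
    by (intro subsetD[OF K.genideal_self])
      (auto simp: mem_carrier_path_algebra is_path_arrow)
  moreover have "n = path_length p'" using Suc(2) wa by (simp add: p'_def)
  then have "path_elt p' \<in> arrow_ideal G [^]\<^bsub>ideals_set (path_algebra G :: (_ \<Rightarrow>\<^sub>0 'k) ring)\<^esub> n"
    using Suc(1)[OF _ p'(1)] by simp
  ultimately show ?case unfolding Suc(2)[symmetric]
    by (simp add: ideals_set_def ideal_prod.prod)
qed


section \<open>Words of a special multiserial algebra\<close>

text \<open>\<open>isolated\<close> uses one arrow for both sides; the two memberships are
  independent of each other, so this expresses the hypothesis with two arrows.\<close>

locale isolated_relations = fin_digraph G for G :: "('v, 'a) pre_digraph" +
  fixes I R :: "(('v, 'a) qpath \<Rightarrow>\<^sub>0 'k::field) set"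
  assumes admissible: "admissible_ideal G I"
    and multiserial: "special_multiserial G I"
    and minimal: "minimal_relations G I R"
    and isolated: "\<lbrakk>\<rho> \<in> R; nonzero_relation G I \<rho>; \<beta> \<in> arcs G; p \<in> Poly_Mapping.keys \<rho>\<rbrakk> \<Longrightarrow>
      arrow_elt G \<beta> \<otimes>\<^bsub>path_algebra G\<^esub> arrow_elt G (hd (arrows p)) \<in> I \<and>
      arrow_elt G (last (arrows p)) \<otimes>\<^bsub>path_algebra G\<^esub> arrow_elt G \<beta> \<in> I"
begin

abbreviation K :: "(('v, 'a) qpath \<Rightarrow>\<^sub>0 'k) ring" where "K \<equiv> path_algebra G"

sublocale K: ring K by (rule path_algebra_ring)

lemma I_ideal: "ideal I K" using admissible by (simp add: admissible_ideal_def)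

sublocale I: ideal I K by (rule I_ideal)

lemma zero_mem_I: "0 \<in> I" using I.zero_closed by simp

text \<open>A single path in \<open>R\<close> is a zero relation, because a nonzero relation has at
  least two keys.\<close>

definition zero_words :: "'a list set" where
  "zero_words = {arrows p | p. is_path G p \<and> path_elt p \<in> R}"

lemma R_cases: "\<rho> \<in> R \<Longrightarrow> zero_relation G I \<rho> \<or> nonzero_relation G I \<rho>"
  using minimal unfolding minimal_relations_def by blast

lemma R_subset_I: "R \<subseteq> I"
  using R_cases by (auto simp: zero_relation_def nonzero_relation_def)

lemma path_elt_carrier: "path_elt p \<in> carrier K \<longleftrightarrow> is_path G p"
  by (simp add: mem_carrier_path_algebra)

lemma R_keys:
  assumes "\<rho> \<in> R" "p \<in> Poly_Mapping.keys \<rho>"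
  shows "is_path G p" "2 \<le> path_length p"
  using R_cases[OF assms(1)] assms(2)
  by (auto simp: zero_relation_def nonzero_relation_def is_relation_def)

lemma zero_words_path:
  assumes "z \<in> zero_words"
  shows "2 \<le> length z" "set z \<subseteq> arcs G" "successively (composable G) z"
    "is_path G (word_path G z)" "path_elt (word_path G z) \<in> R"
proof -
  obtain p where p: "z = arrows p" "is_path G p" "path_elt p \<in> R"
    using assms by (auto simp: zero_words_def)
  show l: "2 \<le> length z" using R_keys(2)[OF p(3), of p] p(1) by simp
  then have "p = word_path G z" using path_eq_word_path[OF p(2)] p(1) by fastforce
  then show "is_path G (word_path G z)" "path_elt (word_path G z) \<in> R" using p by auto
  then show "set z \<subseteq> arcs G" "successively (composable G) z"
    using is_path_word_path[of z] l by fastforce+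
qed

section \<open>Membership of paths in the ideal\<close>

lemma subpath_mem_ideal:
  assumes "ideal J K" "path_elt p \<in> J" "subpath G p q"
  shows "path_elt q \<in> J"
proof -
  from assms(3) obtain x y where xy: "is_path G p" "is_path G x" "is_path G y"
    "tgt x = src p" "tgt p = src y" "q = path_comp x (path_comp p y)"
    unfolding subpath_def by blast
  have "path_elt p \<otimes>\<^bsub>K\<^esub> path_elt y \<in> J"
    using ideal.I_r_closed[OF assms(1,2)] xy path_elt_carrier by blast
  then have "path_elt x \<otimes>\<^bsub>K\<^esub> (path_elt p \<otimes>\<^bsub>K\<^esub> path_elt y) \<in> J"
    using ideal.I_l_closed[OF assms(1)] xy path_elt_carrier by blast
  then show ?thesis using xy by (simp add: path_elt_mult)
qed

text \<open>Otherwise the path of \<open>z'\<close> would lie in the ideal generated by the other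
  relations, against minimality of \<open>R\<close>.\<close>

lemma zero_words_antichain:
  assumes "z \<in> zero_words" "z' \<in> zero_words" "sublist z z'"
  shows "z = z'"
proof (rule ccontr)
  assume "z \<noteq> z'"
  let ?p = "word_path G z" and ?q = "word_path G z'"
  let ?R = "R - {path_elt ?q}"
  note z = zero_words_path[OF assms(1)] and z' = zero_words_path[OF assms(2)]
  have sub: "subpath G ?p ?q"
    using subpath_iff_sublist[of ?p ?q] z z' assms(3) by fastforce
  have RK: "R \<subseteq> carrier K" using R_subset_I I.a_subset by blast
  then have J: "ideal (Idl\<^bsub>K\<^esub> ?R) K" by (intro K.genideal_ideal) auto
  have "?R \<subseteq> Idl\<^bsub>K\<^esub> ?R" using RK by (intro K.genideal_self) auto
  moreover have "path_elt ?p \<in> ?R"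
    using z(5) \<open>z \<noteq> z'\<close> by (auto dest: arg_cong[of _ _ arrows])
  ultimately have "path_elt ?q \<in> Idl\<^bsub>K\<^esub> ?R" using subpath_mem_ideal[OF J _ sub] by blast
  then have "R \<subseteq> Idl\<^bsub>K\<^esub> ?R" using \<open>?R \<subseteq> Idl\<^bsub>K\<^esub> ?R\<close> by blast
  then have "Idl\<^bsub>K\<^esub> R \<subseteq> Idl\<^bsub>K\<^esub> ?R" using J by (intro K.genideal_minimal)
  moreover have "I = Idl\<^bsub>K\<^esub> R" using minimal by (simp add: minimal_relations_def)
  moreover have "Idl\<^bsub>K\<^esub> ?R \<subseteq> I"
    using R_subset_I by (intro K.genideal_minimal[OF I_ideal]) auto
  ultimately have "I = Idl\<^bsub>K\<^esub> ?R" by blast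
  moreover have "?R \<subset> R" using z'(5) by blast
  ultimately show False using minimal unfolding minimal_relations_def by blast
qed

text \<open>The elements all of whose keys contain a key of some relation form an ideal by
  \<open>subpath_keys_ideal\<close>; it contains \<open>R\<close>, hence \<open>I\<close>.\<close>

lemma I_keys:
  assumes "f \<in> I" "q \<in> Poly_Mapping.keys f"
  obtains \<rho> s where "\<rho> \<in> R" "s \<in> Poly_Mapping.keys \<rho>" "subpath G s q"
proof -
  let ?S = "\<Union>\<rho>\<in>R. Poly_Mapping.keys \<rho>"
  let ?J = "{f \<in> carrier K. \<forall>q\<in>Poly_Mapping.keys f. \<exists>s\<in>?S. subpath G s q}"
  have "ideal ?J K" by (rule subpath_keys_ideal) (rule fin_digraph_axioms)
  moreover have "R \<subseteq> ?J"
  proof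
    fix \<rho> assume "\<rho> \<in> R"
    moreover have "subpath G p p" if "is_path G p" for p
      using that is_path_src is_path_tgt unfolding subpath_def
      by (intro conjI exI[of _ "stationary (src p)"] exI[of _ "stationary (tgt p)"])
        (auto simp: path_comp_def)
    ultimately show "\<rho> \<in> ?J" using R_subset_I I.a_subset R_keys(1) by blast
  qed
  ultimately have "Idl\<^bsub>K\<^esub> R \<subseteq> ?J" by (rule K.genideal_minimal)
  then have "f \<in> ?J" using assms(1) minimal by (auto simp: minimal_relations_def)
  then show thesis using assms(2) that by blast
qed

lemma zero_relation_word:
  assumes "zero_relation G I \<rho>" "\<rho> \<in> R" "s \<in> Poly_Mapping.keys \<rho>"
  shows "arrows s \<in> zero_words" "path_elt s \<in> I"
  using assms R_subset_I by (auto simp: zero_relation_def zero_words_def)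

lemma nonzero_relation_key: "nonzero_relation G I \<rho> \<Longrightarrow> s \<in> Poly_Mapping.keys \<rho> \<Longrightarrow> path_elt s \<notin> I"
  by (simp add: nonzero_relation_def)

text \<open>Keys of relations have length at least two, so the one found inside \<open>p\<close> is
  \<open>p\<close> itself; keys of nonzero relations lie outside \<open>I\<close>, which leaves a
  zero relation.\<close>

lemma short_path_in_I:
  assumes "path_elt p \<in> I" "path_length p = 2"
  shows "arrows p \<in> zero_words"
proof -
  obtain \<rho> s where s: "\<rho> \<in> R" "s \<in> Poly_Mapping.keys \<rho>" "subpath G s p"
    using I_keys[OF assms(1), of p] by auto
  then have p: "is_path G p" using assms(1) I.a_subset path_elt_carrier by blast
  have l: "2 \<le> path_length s" using R_keys s by blast
  then have "sublist (arrows s) (arrows p)"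
    using s(3) subpath_iff_sublist[of s p] R_keys(1)[OF s(1,2)] p by fastforce
  then obtain ps ss where e: "arrows p = ps @ arrows s @ ss" by (auto simp: sublist_def)
  then have "length ps + path_length s + length ss = 2" using assms(2) by simp
  then have "length ps = 0" "length ss = 0" using l by linarith+
  then have e: "arrows s = arrows p" using e by simp
  then have "s = p"
    using path_eq_word_path[OF p] path_eq_word_path[OF R_keys(1)[OF s(1,2)]] l by fastforce
  then show ?thesis
    using R_cases[OF s(1)] s zero_relation_word nonzero_relation_key assms(1) by blast
qed

lemma composable_mult:
  assumes "composable G a b"
  shows "arrow_elt G a \<otimes>\<^bsub>K\<^esub> arrow_elt G b = path_elt (word_path G [a, b])"
  using assms by (simp add: path_elt_mult arrow_path_def path_comp_def word_path_def)

text \<open>Uses the hypothesis on nonzero relations: prolonging a key on either side creates a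
  junction of two arrows that is itself a zero relation.\<close>

lemma key_superpath:
  assumes "\<rho> \<in> R" "s \<in> Poly_Mapping.keys \<rho>" "subpath G s q"
  shows "(\<exists>z\<in>zero_words. sublist z (arrows q)) \<or>
    (nonzero_relation G I \<rho> \<and> q \<in> Poly_Mapping.keys \<rho>)"
proof (cases "zero_relation G I \<rho>")
  case True
  have "sublist (arrows s) (arrows q)" using assms(3) by (force simp: subpath_def sublist_def)
  then show ?thesis using zero_relation_word[OF True assms(1,2)] by blast
next
  case False
  then have nz: "nonzero_relation G I \<rho>" using R_cases assms(1) by blast
  obtain x y where xy: "is_path G s" "is_path G x" "is_path G y"
    "tgt x = src s" "tgt s = src y" "q = path_comp x (path_comp s y)"
    using assms(3) unfolding subpath_def by blast
  have s: "arrows s \<noteq> []" using R_keys(2)[OF assms(1,2)] by auto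
  have aw: "successively (composable G) (arrows p) \<and> set (arrows p) \<subseteq> arcs G"
    if "is_path G p" "arrows p \<noteq> []" for p
    using that is_path_word_path path_eq_word_path by metis
  have q: "is_path G q" unfolding xy(6) using xy(1-5) by (intro is_path_comp) auto
  have comp: "successively (composable G) (arrows x @ arrows s @ arrows y)"
    using aw[OF q] s by (simp add: xy(6))
  consider "arrows x \<noteq> []" | "arrows y \<noteq> []" | "arrows x = []" "arrows y = []" by blast
  then show ?thesis
  proof cases
    case 1
    let ?b = "last (arrows x)" and ?c = "hd (arrows s)"
    have "?b \<in> arcs G" using aw[OF xy(2) 1] 1 by auto
    then have "arrow_elt G ?b \<otimes>\<^bsub>K\<^esub> arrow_elt G ?c \<in> I"
      using isolated[OF assms(1) nz _ assms(2)] by blast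
    moreover have "composable G ?b ?c"
      using comp 1 s by (simp add: successively_append_iff)
    ultimately have "[?b, ?c] \<in> zero_words"
      using short_path_in_I[of "word_path G [?b, ?c]"] by (simp add: composable_mult)
    moreover have "arrows q = butlast (arrows x) @ [?b, ?c] @ (tl (arrows s) @ arrows y)"
      using 1 s by (simp add: xy(6))
    ultimately show ?thesis unfolding sublist_def by blast
  next
    case 2
    let ?b = "last (arrows s)" and ?c = "hd (arrows y)"
    have "?c \<in> arcs G" using aw[OF xy(3) 2] 2 by auto
    then have "arrow_elt G ?b \<otimes>\<^bsub>K\<^esub> arrow_elt G ?c \<in> I"
      using isolated[OF assms(1) nz _ assms(2)] by blast
    moreover have "composable G ?b ?c"
      using comp 2 s by (simp add: successively_append_iff)
    ultimately have "[?b, ?c] \<in> zero_words"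
      using short_path_in_I[of "word_path G [?b, ?c]"] by (simp add: composable_mult)
    moreover have "arrows q = (arrows x @ butlast (arrows s)) @ [?b, ?c] @ tl (arrows y)"
      using 2 s by (simp add: xy(6))
    ultimately show ?thesis unfolding sublist_def by blast
  next
    case 3
    then have "q = s"
      using path_eq_word_path[OF q] path_eq_word_path[OF xy(1) s] s by (simp add: xy(6))
    then show ?thesis using nz assms(2) by blast
  qed
qed

text \<open>On single paths \<open>I\<close> behaves like a monomial ideal: a key of a nonzero
  relation is not in \<open>I\<close>, and by \<open>key_superpath\<close> a path reaching beyond
  such a key contains a zero relation.\<close>

lemma path_elt_mem_I_iff:
  assumes "is_path G p"
  shows "path_elt p \<in> I \<longleftrightarrow> (\<exists>z\<in>zero_words. sublist z (arrows p))"
proof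
  assume p: "path_elt p \<in> I"
  then obtain \<rho> s where "\<rho> \<in> R" "s \<in> Poly_Mapping.keys \<rho>" "subpath G s p"
    using I_keys[OF p, of p] by auto
  then show "\<exists>z\<in>zero_words. sublist z (arrows p)"
    using key_superpath nonzero_relation_key p by blast
next
  assume "\<exists>z\<in>zero_words. sublist z (arrows p)"
  then obtain z where z: "z \<in> zero_words" "sublist z (arrows p)" by blast
  note zp = zero_words_path[OF z(1)]
  have "subpath G (word_path G z) p"
    using subpath_iff_sublist[OF zp(4) assms] z(2) zp(1) by fastforce
  then show "path_elt p \<in> I"
    using subpath_mem_ideal[OF I_ideal] zp(5) R_subset_I by blast
qed

lemma key_not_in_I:
  assumes "f \<in> I" "q \<in> Poly_Mapping.keys f" "path_elt q \<notin> I"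
  obtains \<rho> where "\<rho> \<in> R" "nonzero_relation G I \<rho>" "q \<in> Poly_Mapping.keys \<rho>"
proof -
  obtain \<rho> s where s: "\<rho> \<in> R" "s \<in> Poly_Mapping.keys \<rho>" "subpath G s q"
    using I_keys[OF assms(1,2)] by blast
  moreover have "is_path G q"
    using assms I.a_subset mem_carrier_path_algebra by blast
  ultimately show thesis using that key_superpath[OF s] path_elt_mem_I_iff assms(3) by blast
qed

lemma arrow_mult_mem_I_iff:
  assumes "a \<in> arcs G" "b \<in> arcs G"
  shows "arrow_elt G a \<otimes>\<^bsub>K\<^esub> arrow_elt G b \<in> I \<longleftrightarrow> (composable G a b \<longrightarrow> [a, b] \<in> zero_words)"
proof (cases "composable G a b")
  case True
  then have p: "is_path G (word_path G [a, b])" using assms by (simp add: is_path_word_path)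
  have "path_elt (word_path G [a, b]) \<in> I \<longleftrightarrow> [a, b] \<in> zero_words"
    using short_path_in_I[of "word_path G [a, b]"] path_elt_mem_I_iff[OF p] by auto
  with True show ?thesis by (simp add: composable_mult)
next
  case False
  then show ?thesis using zero_mem_I by (simp add: path_elt_mult arrow_path_def)
qed

text \<open>Admissibility provides \<open>m\<close> such that the first \<open>m\<close> letters of
  a long word already form a path in \<open>I\<close>.\<close>

lemma long_words_contain_zero_word:
  "\<exists>n. \<forall>w. set w \<subseteq> arcs G \<and> successively (composable G) w \<and> n \<le> length w \<longrightarrow>
    (\<exists>z\<in>zero_words. sublist z w)"
proof -
  obtain m :: nat where m: "2 \<le> m" "arrow_ideal G [^]\<^bsub>ideals_set K\<^esub> m \<subseteq> I"
    using admissible by (auto simp: admissible_ideal_def)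
  have "\<exists>z\<in>zero_words. sublist z w"
    if w: "set w \<subseteq> arcs G" "successively (composable G) w" "m \<le> length w" for w
  proof -
    let ?p = "word_path G (take m w)"
    have "successively (composable G) (take m w)"
      using successively_sublist[OF w(2) sublist_take] .
    moreover have "take m w \<noteq> []" using m(1) w(3) by auto
    ultimately have p: "is_path G ?p"
      using w(1) set_take_subset[of m w] by (simp add: is_path_word_path)
    have "path_length ?p = m" using w(3) by simp
    then have "path_elt ?p \<in> arrow_ideal G [^]\<^bsub>ideals_set K\<^esub> m"
      using path_elt_mem_arrow_ideal_pow[OF p] by metis
    then have "path_elt ?p \<in> I" using m(2) by blast
    then obtain z where z: "z \<in> zero_words" "sublist z (take m w)"
      using path_elt_mem_I_iff[OF p] by auto
    then show ?thesis using sublist_order.order_trans[OF z(2) sublist_take] by blast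
  qed
  then show ?thesis by blast
qed

sublocale W: special_words "arcs G" "composable G" zero_words
proof
  show "b = c" if "a \<in> arcs G" "b \<in> arcs G" "c \<in> arcs G" "composable G a b" "[a, b] \<notin> zero_words"
    "composable G a c" "[a, c] \<notin> zero_words" for a b c
  proof -
    have "\<exists>\<^sub>\<le>\<^sub>1 \<beta>. \<beta> \<in> arcs G \<and> arrow_elt G a \<otimes>\<^bsub>K\<^esub> arrow_elt G \<beta> \<notin> I"
      using multiserial that(1) by (simp add: special_multiserial_def)
    then show ?thesis by (rule Uniq_D) (use that in \<open>simp_all add: arrow_mult_mem_I_iff\<close>)
  qed
  show "b = c" if "a \<in> arcs G" "b \<in> arcs G" "c \<in> arcs G" "composable G b a" "[b, a] \<notin> zero_words"
    "composable G c a" "[c, a] \<notin> zero_words" for a b c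
  proof -
    have "\<exists>\<^sub>\<le>\<^sub>1 \<gamma>. \<gamma> \<in> arcs G \<and> arrow_elt G \<gamma> \<otimes>\<^bsub>K\<^esub> arrow_elt G a \<notin> I"
      using multiserial that(1) by (simp add: special_multiserial_def)
    then show ?thesis by (rule Uniq_D) (use that in \<open>simp_all add: arrow_mult_mem_I_iff\<close>)
  qed
qed (fact zero_words_path zero_words_antichain long_words_contain_zero_word)+

section \<open>Maximal paths and their residue classes\<close>

lemma good_iff:
  "W.good w \<longleftrightarrow> w \<noteq> [] \<and> is_path G (word_path G w) \<and> path_elt (word_path G w) \<notin> I"
  using path_elt_mem_I_iff[of "word_path G w"] is_path_word_path[of w]
  by (auto simp: W.good_def)

definition max_path :: "('v, 'a) qpath \<Rightarrow> bool" where
  "max_path m \<longleftrightarrow> is_path G m \<and> path_elt m \<notin> I \<and>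
     (\<forall>\<alpha> \<in> arcs G. arrow_elt G \<alpha> \<otimes>\<^bsub>K\<^esub> path_elt m \<in> I \<and> path_elt m \<otimes>\<^bsub>K\<^esub> arrow_elt G \<alpha> \<in> I)"

lemma maximal_paths_eq: "maximal_paths G I = {residue_class G I m | m. max_path m}"
  by (simp add: maximal_paths_def max_path_def)

lemma max_path_word_path_iff:
  assumes "w \<noteq> []"
  shows "max_path (word_path G w) \<longleftrightarrow> W.maximal w"
proof -
  have "arrow_elt G a \<otimes>\<^bsub>K\<^esub> path_elt (word_path G w) \<in> I \<longleftrightarrow> \<not> W.good (a # w)"
    "path_elt (word_path G w) \<otimes>\<^bsub>K\<^esub> arrow_elt G a \<in> I \<longleftrightarrow> \<not> W.good (w @ [a])"
    if "is_path G (word_path G w)" "a \<in> arcs G" for a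
  proof -
    have w: "set w \<subseteq> arcs G" "successively (composable G) w"
      using that(1) assms by (simp_all add: is_path_word_path)
    have "path_comp (arrow_path G a) (word_path G w) = word_path G (a # w)"
      "path_comp (word_path G w) (arrow_path G a) = word_path G (w @ [a])"
      using assms by (simp_all add: path_comp_def arrow_path_def word_path_def)
    then show "arrow_elt G a \<otimes>\<^bsub>K\<^esub> path_elt (word_path G w) \<in> I \<longleftrightarrow> \<not> W.good (a # w)"
      "path_elt (word_path G w) \<otimes>\<^bsub>K\<^esub> arrow_elt G a \<in> I \<longleftrightarrow> \<not> W.good (w @ [a])"
      using w that(2) assms zero_mem_I
      by (auto simp: good_iff is_path_word_path path_elt_mult arrow_path_def
          successively_Cons successively_append_iff)
  qed
  then show ?thesis using assms by (auto simp: max_path_def W.maximal_def good_iff)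
qed

lemma residue_class_eqD:
  assumes "is_path G m" "is_path G m'" "residue_class G I m = residue_class G I m'"
  shows "path_elt m - path_elt m' \<in> I"
proof -
  have "path_elt m \<in> residue_class G I m"
    using zero_mem_I by (force simp: residue_class_def a_r_coset_def')
  then have "path_elt m \<in> residue_class G I m'" using assms(3) by simp
  then obtain i where "i \<in> I" "path_elt m = i + path_elt m'"
    by (auto simp: residue_class_def a_r_coset_def')
  then show ?thesis by simp
qed

text \<open>\<open>UMP\<close> looks for the arrow on any representative of the class, so maximality
  must not depend on the representative; products with an arrow change only by elements of
  \<open>I\<close>.\<close>

lemma max_path_residue_class:
  assumes "max_path m" "is_path G m'" "residue_class G I m' = residue_class G I m"
  shows "max_path m'"
proof -
  let ?d = "path_elt m' - path_elt m"
  have d: "?d \<in> I" using residue_class_eqD assms by (simp add: max_path_def)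
  have e: "path_elt m' = ?d + path_elt m" "path_elt m = path_elt m' + - ?d" by simp_all
  have "path_elt m' \<notin> I"
  proof
    assume "path_elt m' \<in> I"
    moreover have "- ?d \<in> I"
    proof -
      have "\<ominus>\<^bsub>K\<^esub> ?d = - ?d"
      proof (rule K.minus_equality)
        show "?d \<in> carrier K" using d I.a_subset by blast
        then show "- ?d \<in> carrier K" by (simp only: mem_carrier_path_algebra keys_minus)
      qed simp
      then show ?thesis using I.a_inv_closed[OF d] by simp
    qed
    ultimately have "path_elt m' + - ?d \<in> I" using I.a_closed by fastforce
    then show False using assms(1) e(2) by (simp add: max_path_def)
  qed
  moreover have "arrow_elt G \<alpha> \<otimes>\<^bsub>K\<^esub> path_elt m' \<in> I \<and> path_elt m' \<otimes>\<^bsub>K\<^esub> arrow_elt G \<alpha> \<in> I"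
    if "\<alpha> \<in> arcs G" for \<alpha>
  proof -
    have \<alpha>: "arrow_elt G \<alpha> \<in> carrier K" using that by (simp add: path_elt_carrier is_path_arrow)
    have "arrow_elt G \<alpha> \<otimes>\<^bsub>K\<^esub> ?d + arrow_elt G \<alpha> \<otimes>\<^bsub>K\<^esub> path_elt m \<in> I"
      "?d \<otimes>\<^bsub>K\<^esub> arrow_elt G \<alpha> + path_elt m \<otimes>\<^bsub>K\<^esub> arrow_elt G \<alpha> \<in> I"
      using I.I_l_closed[OF d \<alpha>] I.I_r_closed[OF d \<alpha>] assms(1) that I.a_closed
      by (fastforce simp: max_path_def)+
    then show ?thesis by (simp flip: path_algebra_distrib_left path_algebra_distrib_right)
  qed
  ultimately show ?thesis using assms(2) by (simp add: max_path_def)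
qed

text \<open>
  Different maximal paths with the same residue class are keys of nonzero relations, so nothing
  can be composed in front of them and they cannot share an arrow.
\<close>

lemma maximal_residue_class_inj:
  assumes "W.maximal w" "W.maximal w'" "a \<in> set w" "a \<in> set w'"
    and "residue_class G I (word_path G w) = residue_class G I (word_path G w')"
  shows "w = w'"
proof (rule ccontr)
  assume ne: "w \<noteq> w'"
  have no_pred: "\<not> W.N b (hd v)"
    if "W.maximal v" "W.maximal v'" "v \<noteq> v'"
      "residue_class G I (word_path G v) = residue_class G I (word_path G v')" for v v' b
  proof
    assume N: "W.N b (hd v)"
    let ?p = "word_path G v" and ?q = "word_path G v'"
    have p: "is_path G ?p" "is_path G ?q" "path_elt ?p \<notin> I" "v \<noteq> []"
      using that W.maximalD good_iff by blast+
    have "path_elt ?p - path_elt ?q \<in> I" using residue_class_eqD p(1,2) that(4) by blast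
    moreover have "?p \<noteq> ?q" using that(3) inj_word_path by (auto dest: injD)
    then have "?p \<in> Poly_Mapping.keys (path_elt ?p - path_elt ?q :: _ \<Rightarrow>\<^sub>0 'k)"
      by (simp add: in_keys_iff lookup_minus lookup_single)
    \<comment> \<open>The path of \<open>v\<close> is a key of an element of \<open>I\<close>
      without lying in \<open>I\<close>, hence a key of a nonzero relation.\<close>
    ultimately obtain \<rho> where "\<rho> \<in> R" "nonzero_relation G I \<rho>" "?p \<in> Poly_Mapping.keys \<rho>"
      using key_not_in_I p(3) by blast
    moreover have "b \<in> arcs G" "hd v \<in> arcs G" using N by (simp_all add: W.N_def)
    ultimately have "arrow_elt G b \<otimes>\<^bsub>K\<^esub> arrow_elt G (hd v) \<in> I"
      using isolated by fastforce
    then show False using N by (simp add: W.N_def arrow_mult_mem_I_iff)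
  qed
  have "w = w'"
    using W.maximal_eq_if_no_pred[OF assms(1-4)] no_pred[OF assms(1,2) ne assms(5)]
      no_pred[OF assms(2,1)] ne assms(5) by metis
  with ne show False ..
qed

text \<open>After \<open>rep\<close> both sides count maximal words through \<open>a\<close>, once
  up to residue class and once as words; \<open>maximal_residue_class_inj\<close> shows that no two
  of them are identified.\<close>

lemma UMP_iff: "UMP G I \<longleftrightarrow> (\<forall>a\<in>arcs G. \<exists>!w. W.maximal w \<and> a \<in> set w)"
proof -
  let ?c = "\<lambda>w. residue_class G I (word_path G w)"
  have rep: "(M \<in> maximal_paths G I \<and>
      (\<exists>m. is_path G m \<and> residue_class G I m = M \<and> subpath G (arrow_path G a) m)) \<longleftrightarrow>
      (\<exists>w. M = ?c w \<and> W.maximal w \<and> a \<in> set w)" (is "?L \<longleftrightarrow> ?R") if a: "a \<in> arcs G" for a M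
  proof
    assume ?L
    then obtain m0 m where m: "max_path m0" "M = residue_class G I m0" "is_path G m"
      "residue_class G I m = M" "subpath G (arrow_path G a) m"
      by (auto simp: maximal_paths_eq)
    then have "max_path m" using max_path_residue_class by blast
    moreover have "sublist [a] (arrows m)"
      using m(5) subpath_iff_sublist[OF is_path_arrow[OF a] m(3)] by (simp add: arrow_path_def)
    then have "a \<in> set (arrows m)" by (auto dest: set_mono_sublist)
    moreover from this have ne: "arrows m \<noteq> []" by auto
    moreover have "m = word_path G (arrows m)" by (rule path_eq_word_path[OF m(3) ne])
    ultimately show ?R using max_path_word_path_iff m(4) by metis
  next
    assume ?R
    then obtain w where w: "M = ?c w" "W.maximal w" "a \<in> set w" by blast
    then have g: "w \<noteq> []" "is_path G (word_path G w)" using W.maximalD good_iff by blast+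
    then have "max_path (word_path G w)" using w(2) max_path_word_path_iff by blast
    moreover have "sublist [a] w" using w(3) by (auto simp: sublist_def dest: split_list)
    then have "subpath G (arrow_path G a) (word_path G w)"
      using subpath_iff_sublist[OF is_path_arrow[OF a] g(2)] by (simp add: arrow_path_def)
    ultimately show ?L using w(1) g by (auto simp: maximal_paths_eq)
  qed
  have "(\<exists>!M. \<exists>w. M = ?c w \<and> W.maximal w \<and> a \<in> set w) \<longleftrightarrow> (\<exists>!w. W.maximal w \<and> a \<in> set w)"
    (is "?M \<longleftrightarrow> ?W") for a
  proof
    assume M: ?M
    then obtain w where w: "W.maximal w" "a \<in> set w" by auto
    show ?W
    proof (rule ex1I[of _ w])
      fix w' assume w': "W.maximal w' \<and> a \<in> set w'"
      then have "?c w' = ?c w" using M w by blast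
      then show "w' = w" using maximal_residue_class_inj w w' by blast
    qed (use w in simp)
  qed auto
  then have "(\<exists>!M. M \<in> maximal_paths G I \<and>
      (\<exists>m. is_path G m \<and> residue_class G I m = M \<and> subpath G (arrow_path G a) m)) \<longleftrightarrow>
      (\<exists>!w. W.maximal w \<and> a \<in> set w)" if "a \<in> arcs G" for a
    by (simp only: rep[OF that])
  then show ?thesis by (simp only: UMP_def cong: ball_cong)
qed

section \<open>Relations on a cyclic path and the final translation\<close>

text \<open>Sending a word to its basis element is injective and carries the zero words on the cycle
  onto the intersection with \<open>R\<close>. Only single paths occur there, so nonzero relations
  drop out.\<close>

lemma cycle_relations_iff:
  assumes "is_path G u" "tgt u = src u" "arrows u \<noteq> []" "is_path G r" "arrows r \<noteq> []"
  shows "R \<inter> {path_elt w | w p. p \<ge> 1 \<and> subpath G w (path_power u p)} = {path_elt r} \<longleftrightarrow>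
    zero_words \<inter> W.on_cycle (arrows u) = {arrows r}"
proof -
  let ?f = "\<lambda>w. path_elt (word_path G w) :: _ \<Rightarrow>\<^sub>0 'k"
  have inj: "inj ?f" using inj_word_path by (auto simp: inj_def)
  have "R \<inter> {path_elt w | w p. p \<ge> 1 \<and> subpath G w (path_power u p)} =
    ?f ` (zero_words \<inter> W.on_cycle (arrows u))" (is "?L = ?R")
  proof (intro equalityI subsetI)
    fix f assume "f \<in> ?L"
    then obtain w p where w: "f = path_elt w" "path_elt w \<in> R" "1 \<le> p"
      "subpath G w (path_power u p)" by auto
    have pw: "is_path G w" using w(4) by (simp add: subpath_def)
    have ne: "arrows w \<noteq> []" using R_keys(2)[OF w(2), of w] by auto
    have "sublist (arrows w) (W.pow (arrows u) p)"
      using subpath_iff_sublist[OF pw _ ne] path_power_is_path[OF assms(1,2)] w(4) by fastforce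
    then have "arrows w \<in> zero_words \<inter> W.on_cycle (arrows u)"
      using pw w(2,3) by (auto simp: zero_words_def W.on_cycle_def)
    moreover have "f = ?f (arrows w)" using path_eq_word_path[OF pw ne] w(1) by simp
    ultimately show "f \<in> ?R" by blast
  next
    fix f assume "f \<in> ?R"
    then obtain w p where w: "f = ?f w" "w \<in> zero_words" "1 \<le> p"
      "sublist w (W.pow (arrows u) p)" by (auto simp: W.on_cycle_def)
    note zw = zero_words_path[OF w(2)]
    have "subpath G (word_path G w) (path_power u p)"
      using subpath_iff_sublist[OF zw(4)] path_power_is_path[OF assms(1,2)] w(4) zw(1) by fastforce
    then show "f \<in> ?L" using zw(5) w by auto
  qed
  moreover have "path_elt r = ?f (arrows r)" using path_eq_word_path[OF assms(4,5)] by simp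
  ultimately show ?thesis using inj_image_eq_iff[OF inj, of _ "{arrows r}"] by simp
qed

lemma cyclic_path_iff:
  assumes "u \<noteq> []"
  shows "is_path G (word_path G u) \<and> tgt (word_path G u) = src (word_path G u) \<longleftrightarrow>
    set u \<subseteq> arcs G \<and> successively (composable G) (u @ [hd u])"
  using assms by (auto simp: is_path_word_path successively_append_iff)

lemma UMP_iff_cycles:
  "UMP G I \<longleftrightarrow>
    (\<forall>r. is_path G r \<and> path_elt r \<in> R \<and> zero_relation G I (path_elt r) \<and> path_length r > 2 \<longrightarrow>
      (\<exists>u. is_path G u \<and> tgt u = src u \<and>
         R \<inter> {path_elt w | w p. p \<ge> 1 \<and> subpath G w (path_power u p)} = {path_elt r}))"
  (is "_ \<longleftrightarrow> (\<forall>r. ?P r \<longrightarrow> (\<exists>u. ?Q u r))")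
proof -
  let ?V = "\<lambda>r u. u \<noteq> [] \<and> set u \<subseteq> arcs G \<and> successively (composable G) (u @ [hd u]) \<and>
    zero_words \<inter> W.on_cycle u = {r}"
  have cyc: "(\<exists>u. ?Q u r) \<longleftrightarrow> (\<exists>u. ?V (arrows r) u)" if r: "is_path G r" "2 < path_length r" for r
  proof
    assume "\<exists>u. ?Q u r"
    then obtain u where u: "?Q u r" by blast
    have "arrows r \<noteq> []" using r by auto
    \<comment> \<open>\<open>r\<close> lies on a power of \<open>u\<close> and has arrows, so
      \<open>u\<close> is not stationary and can be read as a word.\<close>
    have "path_elt r \<in> {path_elt w | w p. p \<ge> 1 \<and> subpath G w (path_power u p)}"
      using equalityD2[OF conjunct2[OF conjunct2[OF u]]] by simp
    then obtain p where p: "subpath G r (path_power u p)" by auto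
    then have ne: "arrows u \<noteq> []" using \<open>arrows r \<noteq> []\<close>
      by (auto simp: subpath_def dest: arg_cong[of _ _ arrows])
    have u': "is_path G u" "tgt u = src u" using u by simp_all
    have "word_path G (arrows u) = u" using path_eq_word_path[OF u'(1) ne] by simp
    then have "set (arrows u) \<subseteq> arcs G \<and>
        successively (composable G) (arrows u @ [hd (arrows u)])"
      using cyclic_path_iff[OF ne] u' by metis
    moreover have "zero_words \<inter> W.on_cycle (arrows u) = {arrows r}"
      using cycle_relations_iff[OF u' ne r(1) \<open>arrows r \<noteq> []\<close>] u by simp
    ultimately show "\<exists>u. ?V (arrows r) u" using ne by (intro exI[of _ "arrows u"]) simp
  next
    assume "\<exists>u. ?V (arrows r) u"
    then obtain u where u: "?V (arrows r) u" by blast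
    then have c: "is_path G (word_path G u)" "tgt (word_path G u) = src (word_path G u)"
      using cyclic_path_iff by blast+
    have "arrows r \<noteq> []" using r by auto
    then have "R \<inter> {path_elt w | w p. p \<ge> 1 \<and> subpath G w (path_power (word_path G u) p)} =
        {path_elt r}"
      using cycle_relations_iff[OF c _ r(1)] u by simp
    with c show "\<exists>u. ?Q u r" by (intro exI[of _ "word_path G u"] conjI)
  qed
  have zr: "zero_relation G I (path_elt r)" if "path_elt r \<in> R" for r
    using R_cases[OF that] by (auto simp: nonzero_relation_def)
  have "(\<forall>w\<in>zero_words. X w) \<longleftrightarrow> (\<forall>r. is_path G r \<and> path_elt r \<in> R \<longrightarrow> X (arrows r))" for X
    by (auto simp: zero_words_def)
  then have "(\<forall>w\<in>zero_words. 2 < length w \<longrightarrow> (\<exists>u. ?V w u)) \<longleftrightarrow>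
      (\<forall>r. is_path G r \<and> path_elt r \<in> R \<longrightarrow> 2 < path_length r \<longrightarrow> (\<exists>u. ?V (arrows r) u))" .
  also have "\<dots> \<longleftrightarrow> (\<forall>r. ?P r \<longrightarrow> (\<exists>u. ?Q u r))"
  proof (intro iff_allI)
    fix r
    show "(is_path G r \<and> path_elt r \<in> R \<longrightarrow> 2 < path_length r \<longrightarrow> (\<exists>u. ?V (arrows r) u)) \<longleftrightarrow>
        (?P r \<longrightarrow> (\<exists>u. ?Q u r))"
      using cyc[of r] zr[of r] by argo
  qed
  finally show ?thesis unfolding UMP_iff W.unique_maximal_iff .
qed

end

theorem corollary4p2:
  fixes Q :: "('v, 'a) pre_digraph"
    and I R :: "(('v, 'a) qpath \<Rightarrow>\<^sub>0 'k::alg_closed_field) set"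
  assumes "fin_digraph Q" and "connected Q"
    and "admissible_ideal Q I"
    and "special_multiserial Q I"
    and "minimal_relations Q I R"
    and "\<forall>\<rho> \<in> R. nonzero_relation Q I \<rho> \<longrightarrow>
      (\<forall>\<beta> \<in> arcs Q. \<forall>\<gamma> \<in> arcs Q. \<forall>p \<in> Poly_Mapping.keys \<rho>.
         arrow_elt Q \<beta> \<otimes>\<^bsub>path_algebra Q\<^esub> arrow_elt Q (hd (arrows p)) \<in> I \<and>
         arrow_elt Q (last (arrows p)) \<otimes>\<^bsub>path_algebra Q\<^esub> arrow_elt Q \<gamma> \<in> I)"
  shows "UMP Q I \<longleftrightarrow>
    (\<forall>r. is_path Q r \<and> path_elt r \<in> R \<and> zero_relation Q I (path_elt r) \<and> path_length r > 2 \<longrightarrow>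
      (\<exists>u. is_path Q u \<and> tgt u = src u \<and>
         R \<inter> {path_elt w | w p. p \<ge> 1 \<and> subpath Q w (path_power u p)} = {path_elt r}))"
proof -
  interpret fin_digraph Q by fact
  interpret isolated_relations Q I R
    by unfold_locales (use assms in blast)+
  show ?thesis by (rule UMP_iff_cycles)
qed

end
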